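(* Fix an integer $k\ge 2$. There is a randomized algorithm which receives as input a read-once $k$-$x$-basic formula $\Phi$ (with full access to it), parameters $\epsilon>0$ and $\delta>0$, and oracle (query) access to an assignment $\sigma:X\to\{0,1\}$, and which satisfies: if $\sigma\in\mathrm{SAT}(\Phi)$ then it always accepts; if $\sigma$ is $\epsilon$-far from $\mathrm{SAT}(\Phi)$ then it rejects with probability at least $1-\delta$; and, treating $k$ and $\delta$ as constants, its number of queries is always $O(\exp(\mathrm{poly}(\epsilon^{-1})))$.
   Context: A read-once Boolean formula $\Phi$ is a rooted directed tree whose leaves are labeled by variables from a set $X$ (or by constants $0,1$), each variable labeling at most one leaf, and whose every internal vertex $v$ is labeled by a Boolean function of arity equal to its number of children (children ordered). Given an assignment $\sigma:X\to\{0,1\}$ the value at each vertex is computed bottom-up and $\sigma(\Phi)$ is the value at the root. $|\Phi|=|X|$. $\mathrm{SAT}(\Phi)$ is the set of assignments with $\sigma(\Phi)=1$. The distance between two assignments is the fraction of variables of $X$ on which they differ; $\sigma$ is $\epsilon$-far from a set $S$ of assignments if its distance from every member of $S$ is more than $\epsilon$, and $\epsilon$-close otherwise. Each query reveals $\sigma(x)$ for one variable $x$. For a Boolean function $f$, input coordinate $i$ is $(a,b)$-forceful if $f(y)=b$ for every input $y$ with $y_i=a$; it is forceful if it is $(a,b)$-forceful for some $a,b\in\{0,1\}$. A gate is unforceable if none of its input coordinates is forceful. A read-once formula is $k$-$x$-basic if: it is Boolean; every leaf is labeled by a variable (no constants); every internal gate is either a negation whose child is a leaf, or $\wedge$ or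 $\vee$ of arity at least $2$, or an unforceable function of arity between $2$ and $k$; no $\wedge$ gate has a $\wedge$ child and no $\vee$ gate has a $\vee$ child; and every variable appears in at most one leaf (either positively or under a negation). *)

theory Defs
  imports "HOL-Probability.Probability" "HOL-Computational_Algebra.Polynomial"
begin

text \<open>A gate with children \<open>cs\<close> carries a function on \<open>bool list\<close>, of which only
  the values on lists of length \<open>length cs\<close> matter.\<close>

datatype 'x formula =
    Var 'x
  | Const bool
  | Gate "bool list \<Rightarrow> bool" "'x formula list"

primrec value_at :: "('x \<Rightarrow> bool) \<Rightarrow> 'x formula \<Rightarrow> bool" where
  "value_at \<sigma> (Var x) = \<sigma> x"
| "value_at \<sigma> (Const b) = b"
| "value_at \<sigma> (Gate f cs) = f (map (value_at \<sigma>) cs)"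

primrec leaf_vars :: "'x formula \<Rightarrow> 'x list" where
  "leaf_vars (Var x) = [x]"
| "leaf_vars (Const b) = []"
| "leaf_vars (Gate f cs) = concat (map leaf_vars cs)"

primrec subformulas :: "'x formula \<Rightarrow> 'x formula set" where
  "subformulas (Var x) = {Var x}"
| "subformulas (Const b) = {Const b}"
| "subformulas (Gate f cs) = insert (Gate f cs) (\<Union> (set (map subformulas cs)))"

text \<open>The variable set \<open>X\<close> may contain variables that label no leaf; they do count in the
  distance below.\<close>

definition read_once :: "'x set \<Rightarrow> 'x formula \<Rightarrow> bool" where
  "read_once X \<Phi> \<longleftrightarrow> finite X \<and> set (leaf_vars \<Phi>) \<subseteq> X \<and> distinct (leaf_vars \<Phi>)"

definition forceful_with :: "nat \<Rightarrow> (bool list \<Rightarrow> bool) \<Rightarrow> nat \<Rightarrow> bool \<Rightarrow> bool \<Rightarrow> bool" where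
  "forceful_with n f i a b \<longleftrightarrow> (\<forall>ys. length ys = n \<and> ys ! i = a \<longrightarrow> f ys = b)"

definition forceful :: "nat \<Rightarrow> (bool list \<Rightarrow> bool) \<Rightarrow> nat \<Rightarrow> bool" where
  "forceful n f i \<longleftrightarrow> (\<exists>a b. forceful_with n f i a b)"

definition unforceable :: "nat \<Rightarrow> (bool list \<Rightarrow> bool) \<Rightarrow> bool" where
  "unforceable n f \<longleftrightarrow> (\<forall>i<n. \<not> forceful n f i)"

definition is_and :: "nat \<Rightarrow> (bool list \<Rightarrow> bool) \<Rightarrow> bool" where
  "is_and n f \<longleftrightarrow> (\<forall>ys. length ys = n \<longrightarrow> f ys = (\<forall>y\<in>set ys. y))"

definition is_or :: "nat \<Rightarrow> (bool list \<Rightarrow> bool) \<Rightarrow> bool" where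
  "is_or n f \<longleftrightarrow> (\<forall>ys. length ys = n \<longrightarrow> f ys = (\<exists>y\<in>set ys. y))"

definition is_neg :: "nat \<Rightarrow> (bool list \<Rightarrow> bool) \<Rightarrow> bool" where
  "is_neg n f \<longleftrightarrow> n = 1 \<and> (\<forall>y. f [y] = (\<not> y))"

definition k_x_basic :: "nat \<Rightarrow> 'x set \<Rightarrow> 'x formula \<Rightarrow> bool" where
  "k_x_basic k X \<Phi> \<longleftrightarrow>
     read_once X \<Phi> \<and>
     (\<forall>b. Const b \<notin> subformulas \<Phi>) \<and>
     (\<forall>f cs. Gate f cs \<in> subformulas \<Phi> \<longrightarrow>
        (is_neg (length cs) f \<and> (\<exists>x. cs = [Var x])) \<or>
        (2 \<le> length cs \<and> (is_and (length cs) f \<or> is_or (length cs) f)) \<or>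
        (2 \<le> length cs \<and> length cs \<le> k \<and> unforceable (length cs) f)) \<and>
     (\<forall>f cs g ds. Gate f cs \<in> subformulas \<Phi> \<and> Gate g ds \<in> set cs \<longrightarrow>
        \<not> (is_and (length cs) f \<and> is_and (length ds) g) \<and>
        \<not> (is_or (length cs) f \<and> is_or (length ds) g))"

text \<open>Assignments are total functions on the type of variables; only their restriction to the
  variable set \<open>X\<close> enters the distance and, for read-once formulas over \<open>X\<close>, satisfaction.\<close>

definition SAT :: "'x formula \<Rightarrow> ('x \<Rightarrow> bool) set" where
  "SAT \<Phi> = {\<sigma>. value_at \<sigma> \<Phi>}"

definition assignment_dist :: "'x set \<Rightarrow> ('x \<Rightarrow> bool) \<Rightarrow> ('x \<Rightarrow> bool) \<Rightarrow> real" where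
  "assignment_dist X \<sigma> \<tau> = real (card {x \<in> X. \<sigma> x \<noteq> \<tau> x}) / real (card X)"

definition eps_far :: "'x set \<Rightarrow> real \<Rightarrow> ('x \<Rightarrow> bool) \<Rightarrow> ('x \<Rightarrow> bool) set \<Rightarrow> bool" where
  "eps_far X \<epsilon> \<sigma> S \<longleftrightarrow> (\<forall>\<tau>\<in>S. assignment_dist X \<sigma> \<tau> > \<epsilon>)"

text \<open>A deterministic adaptive query algorithm is a decision tree (\<open>Answer True\<close> means
  accept); a randomized one is a probability distribution over decision trees.\<close>

datatype 'x decision_tree =
    Answer bool
  | Query 'x "bool \<Rightarrow> 'x decision_tree"

primrec accepts :: "'x decision_tree \<Rightarrow> ('x \<Rightarrow> bool) \<Rightarrow> bool" where
  "accepts (Answer b) \<sigma> = b"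
| "accepts (Query x t) \<sigma> = accepts (t (\<sigma> x)) \<sigma>"

primrec num_queries :: "'x decision_tree \<Rightarrow> ('x \<Rightarrow> bool) \<Rightarrow> nat" where
  "num_queries (Answer b) \<sigma> = 0"
| "num_queries (Query x t) \<sigma> = Suc (num_queries (t (\<sigma> x)) \<sigma>)"

type_synonym 'x randomized_tree = "'x decision_tree pmf"

end

theory Submission
  imports Defs
begin

text \<open>Test recursively whether a vertex can be given a prescribed value \<open>b\<close> by changing at most an
  \<open>\<epsilon>\<close> fraction of its leaves. If all children must have value \<open>b\<close>, sample children in proportion to
  their size; this lowers \<open>\<epsilon>\<close> slightly for the children. If one child with value \<open>b\<close> suffices, then
  either a small child can be overwritten, or there are few children, and each of them is relatively
  farther from \<open>b\<close> than its parent. At an unforceable gate, only the large children matter; one of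
  them can be left unchanged, so again the others may be tested with a larger \<open>\<epsilon>\<close>. Since the lossy
  steps never follow each other, \<open>\<epsilon>\<close> grows by a fixed polynomial amount every two levels, and after
  \<open>poly(1/\<epsilon>)\<close> levels it exceeds \<open>1\<close>, where there is nothing left to test. The branching at each
  level is polynomial in \<open>1/\<epsilon>\<close> as well.\<close>

section \<open>Combining decision trees\<close>

primrec tree_bind :: "'x decision_tree \<Rightarrow> (bool \<Rightarrow> 'x decision_tree) \<Rightarrow> 'x decision_tree" where
  "tree_bind (Answer b) g = g b"
| "tree_bind (Query x t) g = Query x (\<lambda>b. tree_bind (t b) g)"

lemma accepts_tree_bind: "accepts (tree_bind t g) \<sigma> = accepts (g (accepts t \<sigma>)) \<sigma>"
  by (induction t) auto

lemma num_queries_tree_bind: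
  "num_queries (tree_bind t g) \<sigma> = num_queries t \<sigma> + num_queries (g (accepts t \<sigma>)) \<sigma>"
  by (induction t) auto

lemma set_tree_bind:
  "set_decision_tree (tree_bind t g) \<subseteq> set_decision_tree t \<union> (\<Union>b. set_decision_tree (g b))"
  by (induction t) (fastforce+)

text \<open>The set of accepting indices is accumulated in the continuation \<open>F\<close>, so the
  verdict can be an arbitrary predicate of that set.\<close>

primrec run_all :: "'i list \<Rightarrow> ('i set \<Rightarrow> bool) \<Rightarrow> ('i \<Rightarrow> 'x decision_tree) \<Rightarrow> 'x decision_tree" where
  "run_all [] F T = Answer (F {})"
| "run_all (i # is) F T =
     tree_bind (T i) (\<lambda>b. run_all is (\<lambda>S. F (if b then insert i S else S)) T)"

lemma accepts_run_all:
  "accepts (run_all is F T) \<sigma> = F {i \<in> set is. accepts (T i) \<sigma>}"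
proof (induction "is" arbitrary: F)
  case (Cons i "is")
  have "{j \<in> set (i # is). accepts (T j) \<sigma>} =
    (if accepts (T i) \<sigma> then insert i {i \<in> set is. accepts (T i) \<sigma>} else {i \<in> set is. accepts (T i) \<sigma>})"
    by auto
  then show ?case by (simp only: run_all.simps accepts_tree_bind Cons)
qed simp

lemma num_queries_run_all:
  "num_queries (run_all is F T) \<sigma> = (\<Sum>i\<leftarrow>is. num_queries (T i) \<sigma>)"
  by (induction "is" arbitrary: F) (auto simp: num_queries_tree_bind)

lemma set_run_all:
  "set_decision_tree (run_all is F T) \<subseteq> (\<Union>i\<in>set is. set_decision_tree (T i))"
proof (induction "is" arbitrary: F)
  case (Cons i "is")
  show ?case
    using set_tree_bind[of "T i" "\<lambda>b. run_all is (\<lambda>S. F (if b then insert i S else S)) T"] Cons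
    by fastforce
qed simp

section \<open>Independent runs of randomized trees\<close>

definition bounded_tester :: "'x set \<Rightarrow> nat \<Rightarrow> 'x randomized_tree \<Rightarrow> bool" where
  "bounded_tester V q D \<longleftrightarrow>
     (\<forall>t\<in>set_pmf D. set_decision_tree t \<subseteq> V \<and> (\<forall>\<sigma>. num_queries t \<sigma> \<le> q))"

text \<open>One tree per index is drawn independently. The order of the enumeration is immaterial,
  as the verdict depends only on the set of accepting indices; the default
  \<open>Answer True\<close> sits outside \<open>A\<close> and is never run.\<close>

definition combine ::
    "'i set \<Rightarrow> ('i set \<Rightarrow> bool) \<Rightarrow> ('i \<Rightarrow> 'x randomized_tree) \<Rightarrow> 'x randomized_tree" where
  "combine A F D =
     map_pmf (run_all (SOME is. set is = A \<and> distinct is) F) (Pi_pmf A (Answer True) D)"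

context
  fixes A :: "'i set"
  assumes finA: "finite A"
begin

lemma enumeration:
  "set (SOME is. set is = A \<and> distinct is) = A" "distinct (SOME is. set is = A \<and> distinct is)"
  using someI_ex[OF finite_distinct_list[OF finA]] by auto

lemma set_combine:
  assumes "t \<in> set_pmf (combine A F D)"
  obtains T where "t = run_all (SOME is. set is = A \<and> distinct is) F T"
    "\<And>i. i \<in> A \<Longrightarrow> T i \<in> set_pmf (D i)"
  using assms finA by (auto simp: combine_def set_Pi_pmf PiE_dflt_def)

lemma bounded_tester_combine:
  assumes D: "\<And>i. i \<in> A \<Longrightarrow> bounded_tester V q (D i)" and c: "card A * q \<le> n"
  shows "bounded_tester V n (combine A F D)"
  unfolding bounded_tester_def
proof (intro ballI conjI allI)
  fix t assume "t \<in> set_pmf (combine A F D)"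
  then obtain T where t: "t = run_all (SOME is. set is = A \<and> distinct is) F T"
    and T: "\<And>i. i \<in> A \<Longrightarrow> T i \<in> set_pmf (D i)" by (rule set_combine) auto
  show "set_decision_tree t \<subseteq> V"
    using set_run_all[of "SOME is. set is = A \<and> distinct is" F T] T D
    unfolding t enumeration bounded_tester_def by blast
  fix \<sigma>
  have "num_queries t \<sigma> = (\<Sum>i\<in>A. num_queries (T i) \<sigma>)"
    unfolding t num_queries_run_all
    by (simp add: sum_list_distinct_conv_sum_set enumeration)
  also have "\<dots> \<le> card A * q"
    using T D by (intro sum_bounded_above[where K = q, simplified]) (auto simp: bounded_tester_def)
  finally show "num_queries t \<sigma> \<le> n" using c by simp
qed

text \<open>Indices whose tester accepts with certainty surely belong to the accepting set; nothing
  is known about the others, so \<open>F\<close> has to hold for every set containing the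
  former.\<close>

lemma combine_complete:
  assumes t: "t \<in> set_pmf (combine A F D)"
    and F: "\<And>S. S \<subseteq> A \<Longrightarrow> (\<And>i. i \<in> A \<Longrightarrow> (\<forall>t\<in>set_pmf (D i). accepts t \<sigma>) \<Longrightarrow> i \<in> S) \<Longrightarrow> F S"
  shows "accepts t \<sigma>"
proof -
  from t obtain T where "t = run_all (SOME is. set is = A \<and> distinct is) F T"
    and "\<And>i. i \<in> A \<Longrightarrow> T i \<in> set_pmf (D i)" by (rule set_combine) auto
  then show ?thesis by (auto simp: accepts_run_all enumeration intro!: F)
qed

lemma prob_combine:
  "measure_pmf.prob (combine A F D) {t. accepts t \<sigma>} =
   measure_pmf.prob (Pi_pmf A (Answer True) D) {T. F {i \<in> A. accepts (T i) \<sigma>}}"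
  by (simp add: combine_def vimage_def accepts_run_all enumeration)

text \<open>Union bound: an accepting verdict needs some index of \<open>B\<close> to accept. In the
  applications \<open>B\<close> consists of the tests that ought to reject.\<close>

lemma prob_combine_le:
  fixes d :: real
  assumes B: "B \<subseteq> A" and F: "\<And>S. S \<subseteq> A \<Longrightarrow> S \<inter> B = {} \<Longrightarrow> \<not> F S"
    and d: "\<And>i. i \<in> B \<Longrightarrow> measure_pmf.prob (D i) {t. accepts t \<sigma>} \<le> d"
  shows "measure_pmf.prob (combine A F D) {t. accepts t \<sigma>} \<le> card B * d"
proof -
  let ?P = "Pi_pmf A (Answer True) D"
  have fB: "finite B" using B finA finite_subset by blast
  have "measure_pmf.prob ?P {T. F {i \<in> A. accepts (T i) \<sigma>}}
      \<le> measure_pmf.prob ?P (\<Union>i\<in>B. {T. accepts (T i) \<sigma>})"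
  proof (intro measure_pmf.finite_measure_mono subsetI)
    fix T assume "T \<in> {T. F {i \<in> A. accepts (T i) \<sigma>}}"
    then have "{i \<in> A. accepts (T i) \<sigma>} \<inter> B \<noteq> {}" using F[of "{i \<in> A. accepts (T i) \<sigma>}"] by auto
    then show "T \<in> (\<Union>i\<in>B. {T. accepts (T i) \<sigma>})" by auto
  qed simp
  also have "\<dots> \<le> (\<Sum>i\<in>B. measure_pmf.prob ?P {T. accepts (T i) \<sigma>})"
    by (intro measure_pmf.finite_measure_subadditive_finite fB) auto
  also have "\<dots> = (\<Sum>i\<in>B. measure_pmf.prob (D i) {t. accepts t \<sigma>})"
  proof (intro sum.cong refl)
    fix i assume "i \<in> B"
    then have "i \<in> A" using B by auto
    then have "D i = map_pmf (\<lambda>T. T i) ?P" using finA by (simp add: Pi_pmf_component)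
    then show "measure_pmf.prob ?P {T. accepts (T i) \<sigma>} = measure_pmf.prob (D i) {t. accepts t \<sigma>}"
      by (simp add: vimage_def)
  qed
  also have "\<dots> \<le> card B * d" using d by (intro sum_bounded_above) auto
  finally show ?thesis by (simp add: prob_combine)
qed

lemma prob_combine_all:
  "measure_pmf.prob (combine A (\<lambda>S. S = A) (\<lambda>_. D)) {t. accepts t \<sigma>} =
   measure_pmf.prob D {t. accepts t \<sigma>} ^ card A"
proof -
  have "{T. {i \<in> A. accepts (T i) \<sigma>} = A} = Pi A (\<lambda>_. {t. accepts t \<sigma>})" by auto
  then show ?thesis using finA by (simp add: prob_combine measure_Pi_pmf_Pi)
qed

end

section \<open>Distance to a prescribed value\<close>

abbreviation vars :: "'x formula \<Rightarrow> 'x set" where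
  "vars \<Phi> \<equiv> set (leaf_vars \<Phi>)"

abbreviation size_of :: "'x formula \<Rightarrow> real" where
  "size_of \<Phi> \<equiv> real (card (vars \<Phi>))"

text \<open>Counted absolutely and only over the leaves, so that the distances of children add up at
  a gate. For basic formulas \<open>attains_value\<close> makes the minimum range over a nonempty
  set.\<close>

definition hdist :: "'x formula \<Rightarrow> bool \<Rightarrow> ('x \<Rightarrow> bool) \<Rightarrow> nat" where
  "hdist \<Phi> b \<sigma> = (LEAST n. \<exists>\<tau>. value_at \<tau> \<Phi> = b \<and> card {x \<in> vars \<Phi>. \<sigma> x \<noteq> \<tau> x} = n)"

lemma value_at_cong:
  "(\<And>x. x \<in> vars \<Phi> \<Longrightarrow> \<sigma> x = \<tau> x) \<Longrightarrow> value_at \<sigma> \<Phi> = value_at \<tau> \<Phi>"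
proof (induction \<Phi>)
  case (Gate f cs)
  then have "map (value_at \<sigma>) cs = map (value_at \<tau>) cs" by auto
  then show ?case by (simp only: value_at.simps)
qed auto

lemma hdist_le: "value_at \<tau> \<Phi> = b \<Longrightarrow> hdist \<Phi> b \<sigma> \<le> card {x \<in> vars \<Phi>. \<sigma> x \<noteq> \<tau> x}"
  unfolding hdist_def by (intro Least_le) auto

lemma hdist_eq_0: "value_at \<sigma> \<Phi> = b \<Longrightarrow> hdist \<Phi> b \<sigma> = 0"
  using hdist_le[of \<sigma> \<Phi> b \<sigma>] by simp

lemma self_in_subformulas: "\<Phi> \<in> subformulas \<Phi>"
  by (cases \<Phi>) auto

lemma subformulas_child: "c \<in> set cs \<Longrightarrow> subformulas c \<subseteq> subformulas (Gate f cs)"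
  by auto

lemma k_x_basic_child:
  assumes "k_x_basic k X (Gate f cs)" "c \<in> set cs"
  shows "k_x_basic k X c"
proof -
  have "read_once X c"
    using assms by (auto simp: k_x_basic_def read_once_def distinct_concat_iff)
  then show ?thesis
    using assms subformulas_child[OF assms(2), of f] unfolding k_x_basic_def by blast
qed

lemma k_x_basic_not_Const: "\<not> k_x_basic k X (Const b)"
  by (auto simp: k_x_basic_def)

lemma k_x_basic_read_once: "k_x_basic k X \<Phi> \<Longrightarrow> read_once X \<Phi>"
  by (simp add: k_x_basic_def)

lemma k_x_basic_gate:
  assumes "k_x_basic k X (Gate f cs)"
  shows "(is_neg (length cs) f \<and> (\<exists>x. cs = [Var x])) \<or>
    (2 \<le> length cs \<and> (is_and (length cs) f \<or> is_or (length cs) f)) \<or>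
    (2 \<le> length cs \<and> length cs \<le> k \<and> unforceable (length cs) f)"
  using assms self_in_subformulas[of "Gate f cs"] unfolding k_x_basic_def by blast

text \<open>Fixing coordinate \<open>i\<close> to \<open>a\<close> does not force the output
  \<open>\<not> b\<close>. So one coordinate can be frozen while either output stays
  reachable.\<close>

lemma unforceable_witness:
  assumes "unforceable n f" "i < n"
  obtains ys where "length ys = n" "ys ! i = a" "f ys = b"
  using assms unfolding unforceable_def forceful_def forceful_with_def by metis

lemma disjoint_children:
  assumes "read_once X (Gate f cs)" "i < length cs" "j < length cs" "i \<noteq> j"
  shows "vars (cs ! i) \<inter> vars (cs ! j) = {}"
proof -
  have "distinct (concat (map leaf_vars cs))" using assms(1) by (simp add: read_once_def)
  then show ?thesis using assms(2-4)
  proof (induction cs arbitrary: i j)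
    case (Cons c cs)
    have *: "vars c \<inter> vars (cs ! l) = {}" if "l < length cs" for l
      using Cons.prems(1) that nth_mem[OF that] by fastforce
    show ?case
    proof (cases i)
      case 0
      then show ?thesis using Cons.prems * by (cases j) auto
    next
      case (Suc i')
      then show ?thesis using Cons * by (cases j) (auto simp: Int_commute)
    qed
  qed simp
qed

text \<open>Distinct children have disjoint variables, so assignments chosen separately for the
  children can be glued.\<close>

lemma merge_children:
  assumes ro: "read_once X (Gate f cs)"
  obtains \<tau> where "\<And>i x. i < length cs \<Longrightarrow> x \<in> vars (cs ! i) \<Longrightarrow> \<tau> x = \<rho> i x"
    "value_at \<tau> (Gate f cs) = f (map (\<lambda>i. value_at (\<rho> i) (cs ! i)) [0..<length cs])"
proof
  define \<tau> where "\<tau> x = \<rho> (THE i. i < length cs \<and> x \<in> vars (cs ! i)) x" for x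
  show *: "\<tau> x = \<rho> i x" if "i < length cs" "x \<in> vars (cs ! i)" for i x
  proof -
    have "(THE i. i < length cs \<and> x \<in> vars (cs ! i)) = i"
      using that disjoint_children[OF ro] by (intro the_equality) blast+
    then show ?thesis by (simp add: \<tau>_def)
  qed
  have "map (value_at \<tau>) cs = map (\<lambda>i. value_at (\<rho> i) (cs ! i)) [0..<length cs]"
    using * by (intro nth_equalityI) (auto intro!: value_at_cong)
  then show "value_at \<tau> (Gate f cs) = f (map (\<lambda>i. value_at (\<rho> i) (cs ! i)) [0..<length cs])"
    by (simp only: value_at.simps)
qed

text \<open>There are no constants, and every admissible gate takes both values; an input realizing
  \<open>b\<close> is then realized by the children independently of each other.\<close>

lemma attains_value:
  assumes "k_x_basic k X \<Phi>"
  shows "\<exists>\<tau>. value_at \<tau> \<Phi> = b"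
  using assms
proof (induction \<Phi> arbitrary: b)
  case (Var x)
  show ?case by (intro exI[of _ "\<lambda>_. b"]) simp
next
  case (Const c)
  then show ?case by (simp add: k_x_basic_not_Const)
next
  case (Gate f cs)
  let ?m = "length cs"
  have "\<exists>ys. length ys = ?m \<and> f ys = b"
    using k_x_basic_gate[OF Gate.prems]
  proof (elim disjE conjE)
    assume "is_neg ?m f"
    then show ?thesis by (intro exI[of _ "[\<not> b]"]) (auto simp: is_neg_def)
  next
    assume "2 \<le> ?m" "is_and ?m f"
    then show ?thesis by (intro exI[of _ "replicate ?m b"]) (auto simp: is_and_def)
  next
    assume "2 \<le> ?m" "is_or ?m f"
    then show ?thesis by (intro exI[of _ "replicate ?m b"]) (auto simp: is_or_def)
  next
    assume "2 \<le> ?m" "unforceable ?m f"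
    \<comment> \<open>Only the output is prescribed here, so coordinate 0 may be frozen at any
      value, hence \<open>undefined\<close>.\<close>
    then show ?thesis using unforceable_witness[of ?m f 0 undefined b] by (metis less_le_trans pos2)
  qed
  then obtain ys where ys: "length ys = ?m" "f ys = b" by auto
  have "\<forall>i. \<exists>\<tau>. i < ?m \<longrightarrow> value_at \<tau> (cs ! i) = ys ! i"
  proof
    fix i show "\<exists>\<tau>. i < ?m \<longrightarrow> value_at \<tau> (cs ! i) = ys ! i"
      using Gate.IH[of "cs ! i"] k_x_basic_child[OF Gate.prems, of "cs ! i"] by (cases "i < ?m") auto
  qed
  from choice[OF this] obtain \<rho> where "\<forall>i. i < ?m \<longrightarrow> value_at (\<rho> i) (cs ! i) = ys ! i"
    by (rule exE)
  note \<rho> = this[rule_format]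
  obtain \<tau> where "value_at \<tau> (Gate f cs) = f (map (\<lambda>i. value_at (\<rho> i) (cs ! i)) [0..<?m])"
    by (rule merge_children[OF k_x_basic_read_once[OF Gate.prems], of \<rho>])
  also have "map (\<lambda>i. value_at (\<rho> i) (cs ! i)) [0..<?m] = ys"
    using \<rho> ys by (intro nth_equalityI) auto
  finally show ?case using ys by auto
qed

lemma hdist_attained:
  assumes "k_x_basic k X \<Phi>"
  obtains \<tau> where "value_at \<tau> \<Phi> = b" "card {x \<in> vars \<Phi>. \<sigma> x \<noteq> \<tau> x} = hdist \<Phi> b \<sigma>"
  using LeastI_ex[of "\<lambda>n. \<exists>\<tau>. value_at \<tau> \<Phi> = b \<and> card {x \<in> vars \<Phi>. \<sigma> x \<noteq> \<tau> x} = n"]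
    attains_value[OF assms, of b] unfolding hdist_def by auto

lemma hdist_le_size:
  assumes "k_x_basic k X \<Phi>"
  shows "hdist \<Phi> b \<sigma> \<le> card (vars \<Phi>)"
  by (rule hdist_attained[OF assms, of b \<sigma>]) (metis (lifting) card_mono List.finite_set mem_Collect_eq subsetI)

lemma vars_nonempty: "k_x_basic k X \<Phi> \<Longrightarrow> vars \<Phi> \<noteq> {}"
proof (induction \<Phi>)
  case (Gate f cs)
  have "cs \<noteq> []" using k_x_basic_gate[OF Gate.prems] by auto
  then obtain c where "c \<in> set cs" by (cases cs) auto
  then show ?case using Gate.IH[of c] k_x_basic_child[OF Gate.prems] by auto
qed (auto simp: k_x_basic_not_Const)

lemma size_pos: "k_x_basic k X \<Phi> \<Longrightarrow> size_of \<Phi> > 0"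
  using vars_nonempty by (simp add: card_gt_0_iff)

lemma vars_Gate: "vars (Gate f cs) = (\<Union>i<length cs. vars (cs ! i))"
  by (fastforce simp: in_set_conv_nth)

lemma size_Gate:
  assumes "k_x_basic k X (Gate f cs)"
  shows "card (vars (Gate f cs)) = (\<Sum>i<length cs. card (vars (cs ! i)))"
  unfolding vars_Gate using assms
  by (intro card_UN_disjoint) (auto simp: k_x_basic_def dest: disjoint_children)

text \<open>Change every child optimally to its value in \<open>ys\<close> and glue the results.
  Upper bounds on the distance at a gate come from a suitable choice of \<open>ys\<close>.\<close>

lemma hdist_Gate_le:
  assumes bas: "k_x_basic k X (Gate f cs)" and ys: "length ys = length cs" "f ys = b"
  shows "hdist (Gate f cs) b \<sigma> \<le> (\<Sum>i<length cs. hdist (cs ! i) (ys ! i) \<sigma>)"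
proof -
  let ?m = "length cs"
  have "\<forall>i. \<exists>\<tau>. i < ?m \<longrightarrow> value_at \<tau> (cs ! i) = ys ! i \<and>
      card {x \<in> vars (cs ! i). \<sigma> x \<noteq> \<tau> x} = hdist (cs ! i) (ys ! i) \<sigma>"
    using hdist_attained[OF k_x_basic_child[OF bas nth_mem]] by metis
  from choice[OF this] obtain \<rho> where
    \<rho>: "\<forall>i. i < ?m \<longrightarrow> value_at (\<rho> i) (cs ! i) = ys ! i \<and>
      card {x \<in> vars (cs ! i). \<sigma> x \<noteq> \<rho> i x} = hdist (cs ! i) (ys ! i) \<sigma>"
    by (rule exE)
  obtain \<tau> where \<tau>: "\<And>i x. i < ?m \<Longrightarrow> x \<in> vars (cs ! i) \<Longrightarrow> \<tau> x = \<rho> i x"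
    "value_at \<tau> (Gate f cs) = f (map (\<lambda>i. value_at (\<rho> i) (cs ! i)) [0..<?m])"
    by (rule merge_children[OF k_x_basic_read_once[OF bas], of \<rho>]) blast
  have "map (\<lambda>i. value_at (\<rho> i) (cs ! i)) [0..<?m] = ys"
    using \<rho> ys by (intro nth_equalityI) auto
  then have "hdist (Gate f cs) b \<sigma> \<le> card {x \<in> vars (Gate f cs). \<sigma> x \<noteq> \<tau> x}"
    using \<tau> ys by (intro hdist_le) (simp del: value_at.simps)
  also have "{x \<in> vars (Gate f cs). \<sigma> x \<noteq> \<tau> x} = (\<Union>i<?m. {x \<in> vars (cs ! i). \<sigma> x \<noteq> \<rho> i x})"
    unfolding vars_Gate using \<tau> by auto
  also have "card \<dots> \<le> (\<Sum>i<?m. card {x \<in> vars (cs ! i). \<sigma> x \<noteq> \<rho> i x})"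
    by (intro card_UN_le) simp
  also have "\<dots> = (\<Sum>i<?m. hdist (cs ! i) (ys ! i) \<sigma>)" using \<rho> by simp
  finally show ?thesis .
qed

section \<open>One-sided testers\<close>

definition is_tester ::
    "'x formula \<Rightarrow> bool \<Rightarrow> real \<Rightarrow> real \<Rightarrow> nat \<Rightarrow> 'x randomized_tree \<Rightarrow> bool" where
  "is_tester \<Phi> b \<epsilon> \<delta> q D \<longleftrightarrow> bounded_tester (vars \<Phi>) q D \<and>
     (\<forall>\<sigma>. value_at \<sigma> \<Phi> = b \<longrightarrow> (\<forall>t\<in>set_pmf D. accepts t \<sigma>)) \<and>
     (\<forall>\<sigma>. \<epsilon> * size_of \<Phi> < hdist \<Phi> b \<sigma> \<longrightarrow> measure_pmf.prob D {t. accepts t \<sigma>} \<le> \<delta>)"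

definition testable :: "'x formula \<Rightarrow> bool \<Rightarrow> real \<Rightarrow> real \<Rightarrow> nat \<Rightarrow> bool" where
  "testable \<Phi> b \<epsilon> \<delta> q \<longleftrightarrow> (\<exists>D. is_tester \<Phi> b \<epsilon> \<delta> q D)"

text \<open>Turns existence into a function, so that families of testers for the children can be
  passed to \<open>combine\<close>; the choice does not depend on the assignment.\<close>

definition chosen_tester ::
    "'x formula \<Rightarrow> bool \<Rightarrow> real \<Rightarrow> real \<Rightarrow> nat \<Rightarrow> 'x randomized_tree" where
  "chosen_tester \<Phi> b \<epsilon> \<delta> q = (SOME D. is_tester \<Phi> b \<epsilon> \<delta> q D)"

lemma chosen_tester:
  assumes "testable \<Phi> b \<epsilon> \<delta> q"
  shows "bounded_tester (vars \<Phi>) q (chosen_tester \<Phi> b \<epsilon> \<delta> q)"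
    and "value_at \<sigma> \<Phi> = b \<Longrightarrow> t \<in> set_pmf (chosen_tester \<Phi> b \<epsilon> \<delta> q) \<Longrightarrow> accepts t \<sigma>"
    and "\<epsilon> * size_of \<Phi> < hdist \<Phi> b \<sigma> \<Longrightarrow>
      measure_pmf.prob (chosen_tester \<Phi> b \<epsilon> \<delta> q) {t. accepts t \<sigma>} \<le> \<delta>"
proof -
  have *: "is_tester \<Phi> b \<epsilon> \<delta> q (chosen_tester \<Phi> b \<epsilon> \<delta> q)"
    using assms someI_ex[of "is_tester \<Phi> b \<epsilon> \<delta> q"] by (simp add: testable_def chosen_tester_def)
  show "bounded_tester (vars \<Phi>) q (chosen_tester \<Phi> b \<epsilon> \<delta> q)"
    using * by (simp add: is_tester_def)
  show "value_at \<sigma> \<Phi> = b \<Longrightarrow> t \<in> set_pmf (chosen_tester \<Phi> b \<epsilon> \<delta> q) \<Longrightarrow> accepts t \<sigma>"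
    using * unfolding is_tester_def by blast
  show "\<epsilon> * size_of \<Phi> < hdist \<Phi> b \<sigma> \<Longrightarrow>
      measure_pmf.prob (chosen_tester \<Phi> b \<epsilon> \<delta> q) {t. accepts t \<sigma>} \<le> \<delta>"
    using * unfolding is_tester_def by blast
qed

lemma testable_mono:
  assumes "testable \<Phi> b \<epsilon> \<delta> q" "\<epsilon> \<le> \<epsilon>'" "\<delta> \<le> \<delta>'" "q \<le> q'"
  shows "testable \<Phi> b \<epsilon>' \<delta>' q'"
proof -
  obtain D where D: "is_tester \<Phi> b \<epsilon> \<delta> q D" using assms(1) by (auto simp: testable_def)
  have "\<epsilon> * size_of \<Phi> \<le> \<epsilon>' * size_of \<Phi>" using assms(2) by (intro mult_right_mono) auto
  then have "is_tester \<Phi> b \<epsilon>' \<delta>' q' D"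
    using D assms(3,4) unfolding is_tester_def bounded_tester_def
    by (meson le_less_trans order_trans)
  then show ?thesis by (auto simp: testable_def)
qed

lemma testable_if_never_far:
  assumes "\<And>\<sigma>. hdist \<Phi> b \<sigma> \<le> \<epsilon> * size_of \<Phi>"
  shows "testable \<Phi> b \<epsilon> \<delta> q"
proof -
  have "is_tester \<Phi> b \<epsilon> \<delta> q (return_pmf (Answer True))"
    using assms by (auto simp: is_tester_def bounded_tester_def not_less[symmetric])
  then show ?thesis by (auto simp: testable_def)
qed

text \<open>Changing all leaves is always enough, so always accepting is correct. This ends the
  recursion.\<close>

lemma testable_ge_1:
  assumes bas: "k_x_basic k X \<Phi>" and e: "1 \<le> \<epsilon>"
  shows "testable \<Phi> b \<epsilon> \<delta> q"
proof -
  have "real (hdist \<Phi> b \<sigma>) \<le> 1 * size_of \<Phi>" for \<sigma> using hdist_le_size[OF bas] by simp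
  also have "1 * size_of \<Phi> \<le> \<epsilon> * size_of \<Phi>" using e by (intro mult_right_mono) auto
  finally show ?thesis by (intro testable_if_never_far)
qed

text \<open>Accept only if \<open>R\<close> independent runs all accept: the one-sided error keeps
  completeness intact, and the acceptance probabilities multiply.\<close>

lemma testable_amplify:
  assumes "testable \<Phi> b \<epsilon> \<delta> q"
  shows "testable \<Phi> b \<epsilon> (\<delta> ^ R) (R * q)"
proof -
  define D where "D = chosen_tester \<Phi> b \<epsilon> \<delta> q"
  note D = chosen_tester[OF assms, folded D_def]
  have "is_tester \<Phi> b \<epsilon> (\<delta> ^ R) (R * q) (combine {..<R} (\<lambda>S. S = {..<R}) (\<lambda>_. D))"
    unfolding is_tester_def
  proof (intro conjI allI impI ballI)
    show "bounded_tester (vars \<Phi>) (R * q) (combine {..<R} (\<lambda>S. S = {..<R}) (\<lambda>_. D))"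
      using D(1) by (intro bounded_tester_combine) auto
    fix \<sigma> t assume v: "value_at \<sigma> \<Phi> = b" and t: "t \<in> set_pmf (combine {..<R} (\<lambda>S. S = {..<R}) (\<lambda>_. D))"
    show "accepts t \<sigma>" by (rule combine_complete[OF _ t]) (use D(2)[OF v] in auto)
  next
    fix \<sigma> assume "\<epsilon> * size_of \<Phi> < hdist \<Phi> b \<sigma>"
    from D(3)[OF this]
    show "measure_pmf.prob (combine {..<R} (\<lambda>S. S = {..<R}) (\<lambda>_. D)) {t. accepts t \<sigma>} \<le> \<delta> ^ R"
      by (simp add: prob_combine_all power_mono)
  qed
  then show ?thesis by (auto simp: testable_def)
qed

lemma testable_literal:
  assumes "vars \<Phi> = {x}" "\<And>\<sigma>. value_at \<sigma> \<Phi> = b \<longleftrightarrow> \<sigma> x = c" "0 \<le> \<epsilon>" "0 \<le> \<delta>" "1 \<le> q"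
  shows "testable \<Phi> b \<epsilon> \<delta> q"
proof -
  have "\<sigma> x \<noteq> c" if "\<epsilon> * size_of \<Phi> < hdist \<Phi> b \<sigma>" for \<sigma>
    using that assms hdist_eq_0[of \<sigma> \<Phi> b] by (auto simp: not_less)
  then have "is_tester \<Phi> b \<epsilon> \<delta> q (return_pmf (Query x (\<lambda>y. Answer (y = c))))"
    using assms by (auto simp: is_tester_def bounded_tester_def)
  then show ?thesis by (auto simp: testable_def)
qed

section \<open>Testing a gate from tests of its children\<close>

text \<open>Unifies conjunction with target true and disjunction with target false. Dually,
  \<open>unanimous n f (\<not> b)\<close> says that a single child of value \<open>b\<close>
  suffices for \<open>b\<close>.\<close>

definition unanimous :: "nat \<Rightarrow> (bool list \<Rightarrow> bool) \<Rightarrow> bool \<Rightarrow> bool" where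
  "unanimous n f b \<longleftrightarrow> (\<forall>ys. length ys = n \<longrightarrow> (f ys = b \<longleftrightarrow> (\<forall>y\<in>set ys. y = b)))"

lemma is_and_iff: "is_and n f \<longleftrightarrow> unanimous n f True"
  by (auto simp: is_and_def unanimous_def)

lemma is_or_iff: "is_or n f \<longleftrightarrow> unanimous n f False"
  unfolding is_or_def unanimous_def by (metis (full_types))

lemma size_Gate_real:
  assumes "k_x_basic k X (Gate f cs)"
  shows "size_of (Gate f cs) = (\<Sum>i<length cs. size_of (cs ! i))"
  using size_Gate[OF assms] by (metis of_nat_sum)

lemma vars_child: "i < length cs \<Longrightarrow> vars (cs ! i) \<subseteq> vars (Gate f cs)"
  unfolding vars_Gate by auto

lemma bounded_tester_mono: "bounded_tester V q D \<Longrightarrow> V \<subseteq> V' \<Longrightarrow> bounded_tester V' q D"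
  by (fastforce simp: bounded_tester_def)

lemma measure_bind_pmf_of_set:
  assumes "finite P" "P \<noteq> {}"
  shows "measure_pmf.prob (bind_pmf (pmf_of_set P) D) A = (\<Sum>p\<in>P. measure_pmf.prob (D p) A) / card P"
proof -
  have "emeasure (measure_pmf (bind_pmf (pmf_of_set P) D)) A = ennreal ((\<Sum>p\<in>P. measure_pmf.prob (D p) A) / card P)"
    unfolding emeasure_bind_pmf nn_integral_pmf_of_set[OF assms(2,1)]
    using assms by (simp add: measure_pmf.emeasure_eq_measure sum_nonneg divide_ennreal
        ennreal_of_nat_eq_real_of_nat card_gt_0_iff sum_ennreal)
  then have "measure_pmf.prob (bind_pmf (pmf_of_set P) D) A =
      enn2real (ennreal ((\<Sum>p\<in>P. measure_pmf.prob (D p) A) / card P))"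
    by (subst measure_def) (simp only:)
  then show ?thesis by (simp add: sum_nonneg)
qed

text \<open>A child is sampled with probability proportional to its size. The expected relative distance
  of the sampled child exceeds \<open>\<epsilon>\<close>, so it exceeds \<open>\<epsilon> - \<gamma>\<close> with probability at least \<open>\<gamma>\<close>.\<close>

lemma testable_unanimous:
  assumes bas: "k_x_basic k X (Gate f cs)" and un: "unanimous (length cs) f b"
    and g: "0 < \<gamma>" "\<gamma> \<le> \<epsilon>"
    and ch: "\<And>i. i < length cs \<Longrightarrow> testable (cs ! i) b (\<epsilon> - \<gamma>) (1/2) q"
  shows "testable (Gate f cs) b \<epsilon> (1 - \<gamma> / 2) q"
proof -
  let ?m = "length cs" and ?\<Phi> = "Gate f cs"
  define E where "E i = chosen_tester (cs ! i) b (\<epsilon> - \<gamma>) (1/2) q" for i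
  note E = chosen_tester[OF ch, folded E_def]
  \<comment> \<open>A uniform point of \<open>P\<close>, a child paired with one of its leaves,
    selects a child with probability proportional to its size.\<close>
  define P where "P = (SIGMA i:{..<?m}. vars (cs ! i))"
  define N where "N = size_of ?\<Phi>"
  have cP: "real (card P) = N"
    unfolding P_def N_def size_Gate[OF bas] by (subst card_SigmaI) auto
  have N: "N > 0" unfolding N_def by (rule size_pos[OF bas])
  have "card P > 0" using N unfolding cP[symmetric] by simp
  then have P: "finite P" "P \<noteq> {}" by (auto simp: card_gt_0_iff)
  define D where "D = bind_pmf (pmf_of_set P) (\<lambda>p. E (fst p))"
  have setD: "\<exists>i<?m. t \<in> set_pmf (E i)" if "t \<in> set_pmf D" for t
    using that P by (auto simp: D_def P_def)
  have "is_tester ?\<Phi> b \<epsilon> (1 - \<gamma> / 2) q D"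
    unfolding is_tester_def
  proof (intro conjI allI impI ballI)
    show "bounded_tester (vars ?\<Phi>) q D"
      unfolding bounded_tester_def
    proof
      fix t assume "t \<in> set_pmf D"
      then obtain i where i: "i < ?m" "t \<in> set_pmf (E i)" using setD by blast
      then have "bounded_tester (vars ?\<Phi>) q (E i)"
        using E(1) vars_child bounded_tester_mono by metis
      then show "set_decision_tree t \<subseteq> vars ?\<Phi> \<and> (\<forall>\<sigma>. num_queries t \<sigma> \<le> q)"
        using i unfolding bounded_tester_def by blast
    qed
    fix \<sigma> t assume v: "value_at \<sigma> ?\<Phi> = b" and "t \<in> set_pmf D"
    then obtain i where i: "i < ?m" "t \<in> set_pmf (E i)" using setD by blast
    have "\<forall>y\<in>set (map (value_at \<sigma>) cs). y = b"
      using un v unfolding unanimous_def by (metis length_map value_at.simps(3))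
    then have "value_at \<sigma> (cs ! i) = b" using i by simp
    then show "accepts t \<sigma>" using E(2) i by blast
  next
    fix \<sigma> assume far: "\<epsilon> * size_of ?\<Phi> < hdist ?\<Phi> b \<sigma>"
    let ?h = "\<lambda>i. real (hdist (cs ! i) b \<sigma>)" and ?s = "\<lambda>i. size_of (cs ! i)"
    let ?a = "\<lambda>i. measure_pmf.prob (E i) {t. accepts t \<sigma>}"
    have "hdist ?\<Phi> b \<sigma> \<le> (\<Sum>i<?m. hdist (cs ! i) (replicate ?m b ! i) \<sigma>)"
      using un by (intro hdist_Gate_le[OF bas]) (auto simp: unanimous_def)
    also have "\<dots> = (\<Sum>i<?m. hdist (cs ! i) b \<sigma>)" by simp
    finally have "real (hdist ?\<Phi> b \<sigma>) \<le> (\<Sum>i<?m. ?h i)" by (metis of_nat_le_iff of_nat_sum)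
    then have sumh: "\<epsilon> * N < (\<Sum>i<?m. ?h i)" using far by (simp add: N_def)
    \<comment> \<open>A bound linear in the distance, so that it can be summed. A far child is
      accepted with probability at most 1/2 and its excess is at most its size; for a close child
      the excess is not positive.\<close>
    have a: "?s i * ?a i \<le> ?s i - (?h i - (\<epsilon> - \<gamma>) * ?s i) / 2" if i: "i < ?m" for i
    proof (cases "(\<epsilon> - \<gamma>) * ?s i < ?h i")
      case True
      have "?s i * ?a i \<le> ?s i * (1/2)" using E(3)[OF i True] by (intro mult_left_mono) auto
      moreover have "?h i \<le> ?s i"
        using hdist_le_size[OF k_x_basic_child[OF bas nth_mem[OF i]]] by simp
      moreover have "0 \<le> (\<epsilon> - \<gamma>) * ?s i" using g by simp
      ultimately show ?thesis by argo
    next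
      case False
      have "?s i * ?a i \<le> ?s i * 1" by (intro mult_left_mono) auto
      then show ?thesis using False by argo
    qed
    have "measure_pmf.prob D {t. accepts t \<sigma>} = (\<Sum>p\<in>P. ?a (fst p)) / card P"
      unfolding D_def using P
      by (simp add: measure_bind_pmf_of_set)
    also have "(\<Sum>p\<in>P. ?a (fst p)) = (\<Sum>i<?m. ?s i * ?a i)"
      using sum.Sigma[of "{..<?m}" "\<lambda>i. vars (cs ! i)" "\<lambda>i _. ?a i"]
      by (simp add: P_def case_prod_beta)
    also have "\<dots> / card P \<le> (\<Sum>i<?m. ?s i - (?h i - (\<epsilon> - \<gamma>) * ?s i) / 2) / card P"
      using a by (intro divide_right_mono sum_mono) auto
    also have "(\<Sum>i<?m. ?s i - (?h i - (\<epsilon> - \<gamma>) * ?s i) / 2) =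
        N - ((\<Sum>i<?m. ?h i) - (\<epsilon> - \<gamma>) * N) / 2"
      unfolding N_def size_Gate_real[OF bas]
      by (simp add: sum_subtractf sum_divide_distrib[symmetric] sum_distrib_left[symmetric])
    \<comment> \<open>The distances of the children sum to more than \<open>\<epsilon> * N\<close>,
      so their total excess over \<open>(\<epsilon> - \<gamma>) * N\<close> is more than
      \<open>\<gamma> * N\<close>.\<close>
    also have "\<dots> / card P \<le> (N - \<gamma> * N / 2) / card P"
      using sumh by (intro divide_right_mono) (auto simp: algebra_simps)
    also have "\<dots> = 1 - \<gamma> / 2" unfolding cP using N by (simp add: field_simps)
    finally show "measure_pmf.prob D {t. accepts t \<sigma>} \<le> 1 - \<gamma> / 2" .
  qed
  then show ?thesis by (auto simp: testable_def)
qed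

text \<open>Overwriting child \<open>i\<close> with \<open>b\<close> already gives the gate the
  value \<open>b\<close>; all other children keep their values at no cost.\<close>

lemma hdist_Gate_le_child:
  assumes bas: "k_x_basic k X (Gate f cs)" and un: "unanimous (length cs) f (\<not> b)"
    and i: "i < length cs"
  shows "hdist (Gate f cs) b \<sigma> \<le> hdist (cs ! i) b \<sigma>"
proof -
  let ?ys = "(map (value_at \<sigma>) cs)[i := b]"
  have "b \<in> set ?ys" using i by (simp add: set_update_memI)
  then have "f ?ys = b" using un unfolding unanimous_def by (metis length_list_update length_map)
  then have "hdist (Gate f cs) b \<sigma> \<le> (\<Sum>j<length cs. hdist (cs ! j) (?ys ! j) \<sigma>)"
    by (intro hdist_Gate_le[OF bas]) auto
  also have "\<dots> = (\<Sum>j<length cs. if j = i then hdist (cs ! i) b \<sigma> else 0)"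
    by (intro sum.cong refl) (auto simp: nth_list_update intro!: hdist_eq_0)
  also have "\<dots> = hdist (cs ! i) b \<sigma>" using i by simp
  finally show ?thesis .
qed

text \<open>Unless some child is so small that setting it to \<open>b\<close> is affordable, there are at most \<open>1 / \<epsilon>\<close>
  children, none of relative size above \<open>1 - \<epsilon>\<close>; each child then has relative distance at least
  \<open>\<epsilon> / (1 - \<epsilon>) \<ge> \<epsilon> + \<epsilon>\<^sup>2\<close>.\<close>

lemma testable_disjunctive:
  assumes bas: "k_x_basic k X (Gate f cs)" and un: "unanimous (length cs) f (\<not> b)"
    and m: "2 \<le> length cs" and e: "0 < \<epsilon>" "\<eta> \<le> \<epsilon>\<^sup>2" "0 \<le> \<eta>"
    and W: "1 \<le> real W * \<epsilon>" and d: "0 \<le> \<delta>'" "real W * \<delta>' \<le> \<delta>"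
    and ch: "\<And>i. i < length cs \<Longrightarrow> testable (cs ! i) b (\<epsilon> + \<eta>) \<delta>' q"
  shows "testable (Gate f cs) b \<epsilon> \<delta> (W * q)"
proof -
  let ?m = "length cs" and ?\<Phi> = "Gate f cs"
  let ?s = "\<lambda>i. size_of (cs ! i)"
  define N where "N = size_of ?\<Phi>"
  have N: "N > 0" unfolding N_def by (rule size_pos[OF bas])
  have Ns: "N = (\<Sum>i<?m. ?s i)" unfolding N_def by (rule size_Gate_real[OF bas])
  show ?thesis
  proof (cases "\<exists>i<?m. ?s i \<le> \<epsilon> * N")
    case True
    then obtain i where i: "i < ?m" "?s i \<le> \<epsilon> * N" by blast
    show ?thesis
    proof (rule testable_if_never_far)
      fix \<sigma>
      have "hdist ?\<Phi> b \<sigma> \<le> hdist (cs ! i) b \<sigma>" by (rule hdist_Gate_le_child[OF bas un i(1)])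
      also have "\<dots> \<le> card (vars (cs ! i))"
        by (rule hdist_le_size[OF k_x_basic_child[OF bas nth_mem[OF i(1)]]])
      finally show "hdist ?\<Phi> b \<sigma> \<le> \<epsilon> * size_of ?\<Phi>" using i(2) unfolding N_def by linarith
    qed
  next
    case False
    then have big: "\<epsilon> * N < ?s i" if "i < ?m" for i using that by (meson not_le)
    have "real ?m * (\<epsilon> * N) \<le> N"
      unfolding Ns by (subst Ns[symmetric], rule sum_bounded_below[of "{..<?m}" "\<epsilon> * N" ?s, simplified])
        (use big in force)
    then have "real ?m * \<epsilon> \<le> 1" using N by (simp add: mult.assoc[symmetric])
    then have "real ?m * \<epsilon> \<le> real W * \<epsilon>" using W by linarith
    then have mW: "?m \<le> W" using e by simp
    have small: "(\<epsilon> + \<eta>) * ?s i \<le> \<epsilon> * N" if i: "i < ?m" for i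
    proof -
      obtain j where j: "j < ?m" "j \<noteq> i"
        using m that by (metis One_nat_def Suc_1 Suc_le_lessD less_nat_zero_code linorder_neqE_nat zero_less_Suc order_less_trans)
      have "?s i + ?s j = (\<Sum>l\<in>{i, j}. ?s l)" using j by simp
      also have "\<dots> \<le> N" unfolding Ns using i j by (intro sum_mono2) auto
      finally have si: "?s i \<le> (1 - \<epsilon>) * N" using big[OF j(1)] by (simp add: algebra_simps)
      have "(\<epsilon> + \<eta>) * ?s i \<le> (\<epsilon> + \<epsilon>\<^sup>2) * ((1 - \<epsilon>) * N)"
        using si e by (intro mult_mono) auto
      also have "\<dots> = \<epsilon> * N - \<epsilon> ^ 3 * N" by (simp add: algebra_simps power2_eq_square power3_eq_cube)
      also have "\<dots> \<le> \<epsilon> * N" using e N by simp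
      finally show ?thesis .
    qed
    define D where "D i = chosen_tester (cs ! i) b (\<epsilon> + \<eta>) \<delta>' q" for i
    note D = chosen_tester[OF ch, folded D_def]
    let ?E = "combine {..<?m} (\<lambda>S. S \<noteq> {}) D"
    have "is_tester ?\<Phi> b \<epsilon> \<delta> (W * q) ?E"
      unfolding is_tester_def
    proof (intro conjI allI impI ballI)
      show "bounded_tester (vars ?\<Phi>) (W * q) ?E"
      proof (rule bounded_tester_combine[where q = q])
        fix i assume "i \<in> {..<?m}"
        then have i: "i < ?m" by simp
        show "bounded_tester (vars ?\<Phi>) q (D i)"
          by (rule bounded_tester_mono[OF D(1)[OF i] vars_child[OF i]])
      qed (use mW in simp_all)
      fix \<sigma> t assume v: "value_at \<sigma> ?\<Phi> = b" and t: "t \<in> set_pmf ?E"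
      have "\<exists>y\<in>set (map (value_at \<sigma>) cs). y = b"
        using un[unfolded unanimous_def, rule_format, of "map (value_at \<sigma>) cs"] v by auto
      then obtain i where i: "i < ?m" "value_at \<sigma> (cs ! i) = b" by (auto simp: in_set_conv_nth)
      show "accepts t \<sigma>"
      proof (rule combine_complete[OF _ t])
        fix S assume "\<And>l. l \<in> {..<?m} \<Longrightarrow> \<forall>t\<in>set_pmf (D l). accepts t \<sigma> \<Longrightarrow> l \<in> S"
        from this[of i] show "S \<noteq> {}" using D(2)[OF i] i(1) by auto
      qed simp
    next
      fix \<sigma> assume far: "\<epsilon> * size_of ?\<Phi> < hdist ?\<Phi> b \<sigma>"
      \<comment> \<open>Here every child is far from \<open>b\<close>, so the union bound runs over
        all tests.\<close>
      have "measure_pmf.prob ?E {t. accepts t \<sigma>} \<le> real (card {..<?m}) * \<delta>'"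
      proof (intro prob_combine_le)
        fix i assume i: "i \<in> {..<?m}"
        then have i': "i < ?m" by simp
        have "(\<epsilon> + \<eta>) * ?s i < hdist (cs ! i) b \<sigma>"
          using small[OF i'] far hdist_Gate_le_child[OF bas un i', of \<sigma>] unfolding N_def by linarith
        then show "measure_pmf.prob (D i) {t. accepts t \<sigma>} \<le> \<delta>'" by (rule D(3)[OF i'])
      qed auto
      also have "\<dots> \<le> real W * \<delta>'" using mW d by (intro mult_right_mono) auto
      finally show "measure_pmf.prob ?E {t. accepts t \<sigma>} \<le> \<delta>" using d by linarith
    qed
    then show ?thesis by (auto simp: testable_def)
  qed
qed

text \<open>Pigeonhole: the \<open>k+1\<close> half-open intervals from
  \<open>\<theta> ^ Suc j\<close> to \<open>\<theta> ^ j\<close> are disjoint, and at most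
  \<open>k\<close> values are available to hit them.\<close>

lemma exists_geometric_gap:
  fixes \<theta> :: real
  assumes "m \<le> k" "0 < \<theta>" "\<theta> < 1"
  obtains j where "j \<in> {1..k+1}" "\<And>i. i < m \<Longrightarrow> \<theta> ^ j \<le> s i \<or> s i < \<theta> ^ Suc j"
proof (rule ccontr)
  assume "\<not> thesis"
  then have "\<forall>j\<in>{1..k+1}. \<exists>i<m. \<theta> ^ Suc j \<le> s i \<and> s i < \<theta> ^ j"
    using that by (meson not_le)
  then obtain c where c: "\<And>j. j \<in> {1..k+1} \<Longrightarrow> c j < m \<and> \<theta> ^ Suc j \<le> s (c j) \<and> s (c j) < \<theta> ^ j"
    by metis
  have "c ` {1..k+1} \<subseteq> {..<m}" using c by auto
  then have "card (c ` {1..k+1}) < card {1..k+1}"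
    using assms(1) card_mono[of "{..<m}" "c ` {1..k+1}"] by simp
  then have "\<not> inj_on c {1..k+1}" by (rule pigeonhole)
  then obtain j l where "j \<in> {1..k+1}" "l \<in> {1..k+1}" "c j = c l" "j < l"
    unfolding inj_on_def by (metis linorder_neqE_nat)
  moreover from this have "\<theta> ^ l \<le> \<theta> ^ Suc j" using assms by (intro power_decreasing) auto
  ultimately show False using c[of j] c[of l] by auto
qed

text \<open>Call a child large if its relative size is at least \<open>t = \<theta>\<^sup>j\<close>, with \<open>j\<close> chosen so that all other
  children together are negligible compared with \<open>t\<close>. The large children are tested for both values.
  If the answers are compatible with \<open>b\<close>, then \<open>b\<close> can be reached without changing some large
  child \<open>u\<close>, which saves the fraction \<open>t\<close> of the budget: either the compatible values keep
  such a child, or all large children can be changed to either value, and then unforceability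
  yields suitable values with that of \<open>u\<close> kept.\<close>

lemma testable_unforceable:
  assumes bas: "k_x_basic k X (Gate f cs)" and un: "unforceable (length cs) f"
    and m: "length cs \<le> k" and e: "0 < \<epsilon>" "\<epsilon> < 1"
    and th: "0 < \<theta>" "\<theta> < 1" "real k * \<theta> \<le> \<epsilon> / 2"
    and et: "0 \<le> \<eta>" "\<eta> \<le> \<epsilon> * \<theta> ^ (k+1) / 2"
    and d: "0 \<le> \<delta>'" "real (2 * k) * \<delta>' \<le> \<delta>"
    and ch: "\<And>i a. i < length cs \<Longrightarrow> testable (cs ! i) a (\<epsilon> + \<eta>) \<delta>' q"
  shows "testable (Gate f cs) b \<epsilon> \<delta> (2 * k * q)"
proof -
  let ?m = "length cs" and ?\<Phi> = "Gate f cs"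
  let ?s = "\<lambda>i. size_of (cs ! i)"
  define N where "N = size_of ?\<Phi>"
  have N: "N > 0" unfolding N_def by (rule size_pos[OF bas])
  have Ns: "N = (\<Sum>i<?m. ?s i)" unfolding N_def by (rule size_Gate_real[OF bas])
  obtain j where j: "j \<in> {1..k+1}"
    and gap: "\<And>i. i < ?m \<Longrightarrow> \<theta> ^ j \<le> ?s i / N \<or> ?s i / N < \<theta> ^ Suc j"
    using exists_geometric_gap[OF m th(1,2), where s = "\<lambda>i. ?s i / N"] by blast
  define t where "t = \<theta> ^ j"
  have t: "0 < t" "t \<le> 1" "\<theta> ^ (k+1) \<le> t"
    unfolding t_def using th j power_decreasing[of j "k+1" \<theta>] by (auto intro!: power_le_one)
  have eta: "\<eta> \<le> \<epsilon> * t / 2"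
    using et(2) mult_left_mono[OF t(3), of \<epsilon>] e by linarith
  define L where "L = {i. i < ?m \<and> t * N \<le> ?s i}"
  have notL: "?s i \<le> \<theta> * t * N" if "i < ?m" "i \<notin> L" for i
    using gap[OF that(1)] that N unfolding L_def t_def by (auto simp: field_simps)
  \<comment> \<open>Half of the saving \<open>\<epsilon> * t * N\<close> pays for overwriting all
    small children; the other half covers the increase \<open>\<eta>\<close>, by
    \<open>eta\<close>.\<close>
  have ktN: "real ?m * (\<theta> * t * N) \<le> \<epsilon> * t / 2 * N"
  proof -
    have "real ?m * (\<theta> * t * N) \<le> real k * (\<theta> * t * N)"
      using m th t N by (intro mult_right_mono) auto
    also have "\<dots> = (real k * \<theta>) * (t * N)" by simp
    also have "\<dots> \<le> \<epsilon> / 2 * (t * N)" using th(3) t N by (intro mult_right_mono) auto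
    finally show ?thesis by simp
  qed
  have Lne: "L \<noteq> {}"
  proof
    assume "L = {}"
    then have "N \<le> real ?m * (\<theta> * t * N)"
      unfolding Ns by (subst Ns[symmetric], intro sum_bounded_above[of "{..<?m}" ?s, simplified])
        (use notL in auto)
    then have "N \<le> \<epsilon> * t / 2 * N" using ktN by linarith
    then have "1 \<le> \<epsilon> * t / 2" using N by simp
    moreover have "\<epsilon> * t \<le> 1 * 1" using e t by (intro mult_mono) auto
    ultimately show False by simp
  qed
  have budget: "hdist ?\<Phi> b \<sigma> \<le> \<epsilon> * N"
    if ys: "length ys = ?m" "f ys = b" and u: "u \<in> L" "ys ! u = value_at \<sigma> (cs ! u)"
      and yL: "\<And>i. i \<in> L \<Longrightarrow> hdist (cs ! i) (ys ! i) \<sigma> \<le> (\<epsilon> + \<eta>) * ?s i" for ys u \<sigma>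
  proof -
    have um: "u < ?m" and ut: "t * N \<le> ?s u" using u by (auto simp: L_def)
    let ?h = "\<lambda>i. real (hdist (cs ! i) (ys ! i) \<sigma>)"
    \<comment> \<open>A single bound valid for the kept child, the other large children and the
      small ones, so that it can be summed.\<close>
    have h: "?h i \<le> (\<epsilon> + \<eta>) * ?s i + \<theta> * t * N - (if i = u then (\<epsilon> + \<eta>) * ?s i else 0)"
      if i: "i < ?m" for i
    proof -
      have 0: "0 \<le> \<theta> * t * N" "0 \<le> (\<epsilon> + \<eta>) * ?s i" using th t N e et by auto
      show ?thesis
      proof (cases "i = u")
        case True
        then show ?thesis using u 0 hdist_eq_0[of \<sigma> "cs ! u" "ys ! u"] by simp
      next
        case iu: False
        show ?thesis
        proof (cases "i \<in> L")
          case True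
          then show ?thesis using yL[OF True] iu 0 by simp
        next
          case False
          have "?h i \<le> ?s i"
            using hdist_le_size[OF k_x_basic_child[OF bas nth_mem[OF i]]] by simp
          then show ?thesis using notL[OF i False] iu 0 by simp
        qed
      qed
    qed
    have "real (hdist ?\<Phi> b \<sigma>) \<le> (\<Sum>i<?m. ?h i)"
      using hdist_Gate_le[OF bas ys, of \<sigma>] by (metis of_nat_le_iff of_nat_sum)
    also have "\<dots> \<le> (\<Sum>i<?m. (\<epsilon> + \<eta>) * ?s i + \<theta> * t * N - (if i = u then (\<epsilon> + \<eta>) * ?s i else 0))"
      using h by (intro sum_mono) auto
    also have "\<dots> = (\<epsilon> + \<eta>) * N + real ?m * (\<theta> * t * N) - (\<epsilon> + \<eta>) * ?s u"
      using um by (simp add: sum_subtractf sum.distrib sum_distrib_left[symmetric] Ns[symmetric])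
    also have "\<dots> \<le> (\<epsilon> + \<eta>) * N + \<epsilon> * t / 2 * N - (\<epsilon> + \<eta>) * (t * N)"
      using ktN mult_left_mono[OF ut, of "\<epsilon> + \<eta>"] e et by linarith
    also have "\<dots> = (\<epsilon> + (\<eta> - \<epsilon> * t / 2) - \<eta> * t) * N" by (simp add: algebra_simps)
    also have "\<dots> \<le> \<epsilon> * N"
    proof (intro mult_right_mono)
      have "0 \<le> \<eta> * t" using et t by simp
      then show "\<epsilon> + (\<eta> - \<epsilon> * t / 2) - \<eta> * t \<le> \<epsilon>" using eta by linarith
    qed (use N in simp)
    finally show ?thesis .
  qed
  define D where "D p = chosen_tester (cs ! fst p) (snd p) (\<epsilon> + \<eta>) \<delta>' q" for p
  have D1: "bounded_tester (vars (cs ! i)) q (D (i, a))" if "i < ?m" for i a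
    using chosen_tester(1)[OF ch[OF that]] by (simp add: D_def)
  have D2: "accepts T \<sigma>" if "i < ?m" "value_at \<sigma> (cs ! i) = a" "T \<in> set_pmf (D (i, a))" for i a T \<sigma>
    using chosen_tester(2)[OF ch[OF that(1)]] that by (simp add: D_def)
  have D3: "measure_pmf.prob (D (i, a)) {T. accepts T \<sigma>} \<le> \<delta>'"
    if "i < ?m" "(\<epsilon> + \<eta>) * ?s i < hdist (cs ! i) a \<sigma>" for i a \<sigma>
    using chosen_tester(3)[OF ch[OF that(1)] that(2)] by (simp add: D_def)
  define A where "A = L \<times> (UNIV :: bool set)"
  have finL: "finite L" "L \<subseteq> {..<?m}" by (auto simp: L_def)
  have finA: "finite A" unfolding A_def using finL by auto
  have "card L \<le> k" using card_mono[OF _ finL(2)] m by simp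
  then have cA: "card A \<le> 2 * k" unfolding A_def card_cartesian_product by simp
  \<comment> \<open>Small children are left unconstrained, since overwriting them is
    affordable.\<close>
  define F where
    "F S \<longleftrightarrow> (\<exists>ys. length ys = ?m \<and> f ys = b \<and> (\<forall>i\<in>L. (i, ys ! i) \<in> S))" for S
  let ?E = "combine A F D"
  have "is_tester ?\<Phi> b \<epsilon> \<delta> (2 * k * q) ?E"
    unfolding is_tester_def
  proof (intro conjI allI impI ballI)
    show "bounded_tester (vars ?\<Phi>) (2 * k * q) ?E"
    proof (rule bounded_tester_combine[OF finA, where q = q])
      fix p assume "p \<in> A"
      then obtain i a where p: "p = (i, a)" and i: "i < ?m" by (auto simp: A_def L_def)
      show "bounded_tester (vars ?\<Phi>) q (D p)"
        unfolding p by (rule bounded_tester_mono[OF D1[OF i] vars_child[OF i]])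
    qed (use cA in simp)
    fix \<sigma> T assume v: "value_at \<sigma> ?\<Phi> = b" and T: "T \<in> set_pmf ?E"
    show "accepts T \<sigma>"
    proof (rule combine_complete[OF finA T])
      fix S assume "\<And>p. p \<in> A \<Longrightarrow> \<forall>T\<in>set_pmf (D p). accepts T \<sigma> \<Longrightarrow> p \<in> S"
      then have "\<forall>i\<in>L. (i, map (value_at \<sigma>) cs ! i) \<in> S"
        using D2 by (auto simp: A_def L_def)
      then show "F S" using v unfolding F_def by (intro exI[of _ "map (value_at \<sigma>) cs"]) simp
    qed
  next
    fix \<sigma> assume far: "\<epsilon> * size_of ?\<Phi> < hdist ?\<Phi> b \<sigma>"
    define B where "B = {(i, a) \<in> A. (\<epsilon> + \<eta>) * ?s i < hdist (cs ! i) a \<sigma>}"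
    have BA: "B \<subseteq> A" by (auto simp: B_def)
    have "measure_pmf.prob ?E {T. accepts T \<sigma>} \<le> real (card B) * \<delta>'"
    proof (intro prob_combine_le[OF finA BA])
      fix p assume "p \<in> B"
      then show "measure_pmf.prob (D p) {T. accepts T \<sigma>} \<le> \<delta>'"
        using D3 by (auto simp: B_def A_def L_def)
    next
      fix S assume SA: "S \<subseteq> A" and SB: "S \<inter> B = {}"
      have close: "hdist (cs ! i) a \<sigma> \<le> (\<epsilon> + \<eta>) * ?s i" if "(i, a) \<in> S" for i a
        using that SA SB by (force simp: B_def)
      show "\<not> F S"
      proof
        assume "F S"
        then obtain ys where ys: "length ys = ?m" "f ys = b" "\<And>i. i \<in> L \<Longrightarrow> (i, ys ! i) \<in> S"
          by (auto simp: F_def)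
        have "hdist ?\<Phi> b \<sigma> \<le> \<epsilon> * N"
        proof (cases "\<exists>u\<in>L. ys ! u = value_at \<sigma> (cs ! u)")
          case True
          then obtain u where u: "u \<in> L" "ys ! u = value_at \<sigma> (cs ! u)" by blast
          show ?thesis by (rule budget[OF ys(1,2) u close[OF ys(3)]])
        next
          case False
          obtain u where u: "u \<in> L" using Lne by blast
          then have "u < ?m" by (simp add: L_def)
          then obtain zs where zs: "length zs = ?m" "zs ! u = value_at \<sigma> (cs ! u)" "f zs = b"
            by (rule unforceable_witness[OF un])
          \<comment> \<open>On a large child \<open>zs\<close> agrees either with \<open>ys\<close>,
            whose entry passed its test, or with the present value, which is free.\<close>
          have zL: "hdist (cs ! i) (zs ! i) \<sigma> \<le> (\<epsilon> + \<eta>) * ?s i" if i: "i \<in> L" for i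
          proof (cases "zs ! i = ys ! i")
            case True
            show ?thesis unfolding True by (rule close[OF ys(3)[OF i]])
          next
            case ne: False
            then have "value_at \<sigma> (cs ! i) = zs ! i" using False i by auto
            then show ?thesis using hdist_eq_0[of \<sigma> "cs ! i" "zs ! i"] e et by simp
          qed
          show ?thesis by (rule budget[OF zs(1,3) u zs(2) zL])
        qed
        then show False using far by (simp add: N_def)
      qed
    qed
    also have "\<dots> \<le> real (2 * k) * \<delta>'"
      using card_mono[OF finA BA] cA d by (intro mult_right_mono) auto
    finally show "measure_pmf.prob ?E {T. accepts T \<sigma>} \<le> \<delta>" using d by linarith
  qed
  then show ?thesis by (auto simp: testable_def)
qed

section \<open>The recursion\<close>

text \<open>Marks the vertices that are tested without the lossy sampling step; variables satisfy it
  vacuously.\<close>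

definition non_unanimous :: "'x formula \<Rightarrow> bool \<Rightarrow> bool" where
  "non_unanimous \<Phi> b \<longleftrightarrow> (\<forall>f cs. \<Phi> = Gate f cs \<longrightarrow> \<not> unanimous (length cs) f b)"

text \<open>A gate unanimous for \<open>b\<close> is a conjunction or a disjunction according to
  \<open>b\<close>, and neither may have a child of its own kind. Hence lossy steps are never
  consecutive.\<close>

lemma child_non_unanimous:
  assumes bas: "k_x_basic k X (Gate f cs)" and un: "unanimous (length cs) f b" and c: "c \<in> set cs"
  shows "non_unanimous c b"
  unfolding non_unanimous_def
proof (intro allI impI notI)
  fix g ds assume "c = Gate g ds" and un': "unanimous (length ds) g b"
  then have "Gate f cs \<in> subformulas (Gate f cs) \<and> Gate g ds \<in> set cs"
    using c self_in_subformulas by metis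
  then have "\<not> (is_and (length cs) f \<and> is_and (length ds) g) \<and>
      \<not> (is_or (length cs) f \<and> is_or (length ds) g)"
    using bas unfolding k_x_basic_def by blast
  then show False using un un' by (cases b) (simp_all add: is_and_iff is_or_iff)
qed

text \<open>Passing through an unforceable gate, or through a gate where one child with value \<open>b\<close> suffices,
  raises the distance parameter by \<open>2 * \<gamma>\<close>; a gate where all children need value \<open>b\<close> lowers it by
  \<open>\<gamma>\<close>, but never twice in a row. Beyond \<open>1\<close> nothing is far, so \<open>1 / \<gamma>\<close> rounds suffice.\<close>

context
  fixes k :: nat and \<epsilon>\<^sub>0 \<theta> \<gamma> :: real and W :: nat and X :: "'x set"
  assumes k: "1 \<le> k" and e0: "0 < \<epsilon>\<^sub>0" "\<epsilon>\<^sub>0 < 1"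
    and theta: "\<theta> = \<epsilon>\<^sub>0 / (2 * real k)" and gamma: "\<gamma> = \<epsilon>\<^sub>0 * \<theta> ^ (k+1) / 4"
    and W: "1 / \<gamma> \<le> real W"
begin

lemma theta_bounds: "0 < \<theta>" "\<theta> < 1" "real k * \<theta> = \<epsilon>\<^sub>0 / 2" "\<theta> \<le> \<epsilon>\<^sub>0" "\<theta> ^ (k+1) \<le> \<theta>"
proof -
  show *: "0 < \<theta>" "real k * \<theta> = \<epsilon>\<^sub>0 / 2" using k e0 by (simp_all add: theta)
  have "1 * \<theta> \<le> real k * \<theta>" using k * by (intro mult_right_mono) auto
  then show "\<theta> \<le> \<epsilon>\<^sub>0" and t1: "\<theta> < 1" using * e0 by linarith+
  have "\<theta> * \<theta> ^ k \<le> \<theta> * 1" using * t1 by (intro mult_left_mono power_le_one) auto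
  then show "\<theta> ^ (k+1) \<le> \<theta>" by simp
qed

text \<open>By definition \<open>2 * \<gamma>\<close> is
  \<open>\<epsilon>\<^sub>0 * \<theta> ^ (k+1) / 2\<close>, the gain available at unforceable gates;
  the third bound keeps it within the gain at gates where one child suffices.\<close>

lemma gamma_bounds: "0 < \<gamma>" "\<gamma> \<le> \<epsilon>\<^sub>0" "2 * \<gamma> \<le> \<epsilon>\<^sub>0\<^sup>2" "2 * real k * \<gamma> \<le> 1"
proof -
  note t = theta_bounds
  show g0: "0 < \<gamma>" using t e0 by (simp add: gamma)
  have "\<epsilon>\<^sub>0 * \<theta> ^ (k+1) \<le> \<epsilon>\<^sub>0 * \<theta>" using t(5) e0 by (intro mult_left_mono) auto
  then have g: "4 * \<gamma> \<le> \<epsilon>\<^sub>0 * \<theta>" by (simp add: gamma)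
  have "\<epsilon>\<^sub>0 * \<theta> \<le> \<epsilon>\<^sub>0 * \<epsilon>\<^sub>0" using t e0 by (intro mult_left_mono) auto
  then show "2 * \<gamma> \<le> \<epsilon>\<^sub>0\<^sup>2" using g g0 unfolding power2_eq_square by linarith
  have "\<epsilon>\<^sub>0 * \<theta> \<le> 1 * \<theta>" using t e0 by (intro mult_right_mono) auto
  then have gt: "4 * \<gamma> \<le> \<theta>" using g by linarith
  then show "\<gamma> \<le> \<epsilon>\<^sub>0" using t g0 by linarith
  have "real k * (4 * \<gamma>) \<le> real k * \<theta>" using gt by (intro mult_left_mono) auto
  then show "2 * real k * \<gamma> \<le> 1" using t e0 by linarith
qed

text \<open>\<open>W\<close> serves as the number of rounds, as a bound on the number of children
  where one suffices, and as a bound on the \<open>2 * k\<close> tests at an unforceable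
  gate.\<close>

lemma W_bounds: "1 \<le> real W * \<gamma>" "1 \<le> real W * \<epsilon>\<^sub>0" "2 * k \<le> W" "1 \<le> W"
proof -
  note g = gamma_bounds
  show *: "1 \<le> real W * \<gamma>" using W g(1) by (simp add: field_simps)
  have "real W * \<gamma> \<le> real W * \<epsilon>\<^sub>0" using g by (intro mult_left_mono) auto
  then show "1 \<le> real W * \<epsilon>\<^sub>0" using * by linarith
  have "2 * real k \<le> 1 / \<gamma>" using g by (simp add: field_simps)
  then show "2 * k \<le> W" using W by linarith
  then show "1 \<le> W" using k by linarith
qed

text \<open>At most \<open>W\<close> tests are combined at a gate that is not unanimous, so this
  error for each of them keeps the union bound at 1/2.\<close>

lemma amplify_half:
  assumes "testable \<Phi> b \<epsilon> (1/2) q"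
  shows "testable \<Phi> b \<epsilon> (1 / (2 * real W)) (2 * W * q)"
proof -
  have "real (2 * W) < 2 ^ (2 * W)" by (rule of_nat_less_two_power)
  then have "(1/2 :: real) ^ (2 * W) \<le> 1 / (2 * real W)"
    using W_bounds(4) by (simp add: power_one_over field_simps)
  then show ?thesis using testable_mono[OF testable_amplify[OF assms, of "2 * W"]] by auto
qed

text \<open>By \<open>1 - x \<le> exp (- x)\<close> and \<open>W * \<gamma> \<ge> 1\<close> the
  power is at most \<open>exp (- 1)\<close>.\<close>

lemma power_amplify: "(1 - \<gamma> / 2) ^ (2 * W) \<le> 1 / 2"
proof -
  have "(1 - \<gamma> / 2) ^ (2 * W) \<le> exp (- (\<gamma> / 2)) ^ (2 * W)"
    using exp_ge_add_one_self[of "- (\<gamma> / 2)"] gamma_bounds e0 by (intro power_mono) auto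
  also have "\<dots> = exp (- (real W * \<gamma>))" by (simp add: exp_of_nat_mult[symmetric])
  also have "\<dots> \<le> exp (- 1)" using W_bounds(1) by simp
  also have "\<dots> \<le> 1 / 2"
    using exp_ge_add_one_self[of 1] by (simp add: exp_minus field_simps)
  finally show ?thesis .
qed

text \<open>Below a unanimous root the children are not unanimous, so \<open>IH\<close> applies to
  them at \<open>\<epsilon> - \<gamma>\<close>; \<open>2 * W\<close> repetitions of the sampling
  restore the error 1/2.\<close>

lemma testable_step:
  assumes IH: "\<And>\<Phi> b \<epsilon>. k_x_basic k X \<Phi> \<Longrightarrow> \<epsilon>\<^sub>0 \<le> \<epsilon> \<Longrightarrow> 1 - real n * \<gamma> \<le> \<epsilon> \<Longrightarrow>
      non_unanimous \<Phi> b \<Longrightarrow> testable \<Phi> b \<epsilon> (1/2) Q"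
    and bas: "k_x_basic k X \<Phi>" and e: "\<epsilon>\<^sub>0 + \<gamma> \<le> \<epsilon>" "1 - real n * \<gamma> + \<gamma> \<le> \<epsilon>"
  shows "testable \<Phi> b \<epsilon> (1/2) (2 * W * Q)"
proof (cases "non_unanimous \<Phi> b")
  case True
  have "testable \<Phi> b \<epsilon> (1/2) Q" using e gamma_bounds(1) by (intro IH bas True) auto
  then show ?thesis using W_bounds(4) by (elim testable_mono) auto
next
  case False
  then obtain f cs where \<Phi>: "\<Phi> = Gate f cs" and un: "unanimous (length cs) f b"
    by (auto simp: non_unanimous_def)
  note bas = bas[unfolded \<Phi>]
  have "testable (cs ! i) b (\<epsilon> - \<gamma>) (1/2) Q" if "i < length cs" for i
    using e that
    by (intro IH k_x_basic_child[OF bas] child_non_unanimous[OF bas un]) auto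
  then have "testable \<Phi> b \<epsilon> (1 - \<gamma> / 2) Q"
    unfolding \<Phi> using gamma_bounds e0 e by (intro testable_unanimous[OF bas un]) auto
  from testable_amplify[OF this, of "2 * W"] show ?thesis
    by (rule testable_mono) (use power_amplify in auto)
qed

text \<open>The gate gains \<open>2 * \<gamma>\<close>, of which a unanimous child loses
  \<open>\<gamma>\<close> again in \<open>testable_step\<close>; the net gain
  \<open>\<gamma>\<close> is what lowering \<open>n\<close> by one demands.\<close>

lemma testable_non_unanimous:
  assumes "k_x_basic k X \<Phi>" "\<epsilon>\<^sub>0 \<le> \<epsilon>" "1 - real n * \<gamma> \<le> \<epsilon>" "non_unanimous \<Phi> b"
  shows "testable \<Phi> b \<epsilon> (1/2) ((4 * W ^ 3) ^ n)"
  using assms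
proof (induction n arbitrary: \<Phi> b \<epsilon>)
  case 0
  then show ?case by (intro testable_ge_1) auto
next
  case (Suc n)
  let ?Q = "(4 * W ^ 3) ^ n"
  \<comment> \<open>Up to \<open>W\<close> tests at the gate, \<open>2 * W\<close> runs of each to
    reduce its error, and \<open>2 * W\<close> runs inside \<open>testable_step\<close>.\<close>
  have Q: "(4 * W ^ 3) ^ Suc n = W * (2 * W * (2 * W * ?Q))"
    by (simp add: power3_eq_cube)
  have Q1: "1 \<le> (4 * W ^ 3) ^ Suc n" using W_bounds(4) by simp
  note bas = Suc.prems(1) and e = Suc.prems(2)
  have e_pos: "0 < \<epsilon>" using e e0 by linarith
  show ?case
  proof (cases "1 \<le> \<epsilon>")
    case True
    then show ?thesis by (rule testable_ge_1[OF bas])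
  next
    case False
    have ch: "testable \<Psi> a (\<epsilon> + 2 * \<gamma>) (1 / (2 * real W)) (2 * W * (2 * W * ?Q))"
      if "k_x_basic k X \<Psi>" for \<Psi> a
      using Suc.prems(2,3) gamma_bounds(1)
      by (intro amplify_half testable_step[OF Suc.IH] that) (auto simp: algebra_simps)
    show ?thesis
    proof (cases \<Phi>)
      case (Var x)
      then show ?thesis using e_pos Q1 by (intro testable_literal[of _ x _ b]) auto
    next
      case (Const c)
      then show ?thesis using bas k_x_basic_not_Const by auto
    next
      case \<Phi>: (Gate f cs)
      let ?m = "length cs"
      note bas = bas[unfolded \<Phi>]
      have chi: "testable (cs ! i) a (\<epsilon> + 2 * \<gamma>) (1 / (2 * real W)) (2 * W * (2 * W * ?Q))"
        if "i < ?m" for i a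
        by (rule ch[OF k_x_basic_child[OF bas nth_mem[OF that]]])
      have nu: "\<not> unanimous ?m f b" using Suc.prems(4) by (simp add: \<Phi> non_unanimous_def)
      from k_x_basic_gate[OF bas] consider
        x where "is_neg ?m f" "cs = [Var x]"
        | "2 \<le> ?m" "unanimous ?m f (\<not> b)"
        | "2 \<le> ?m" "?m \<le> k" "unforceable ?m f"
        using nu by (cases b) (auto simp: is_and_iff is_or_iff)
      then show ?thesis
      proof cases
        case 1
        then show ?thesis unfolding \<Phi> using e_pos Q1
          by (intro testable_literal[of _ x _ "\<not> b"]) (auto simp: is_neg_def)
      next
        case 2
        have "\<epsilon>\<^sub>0\<^sup>2 \<le> \<epsilon>\<^sup>2" using e e0 by (intro power_mono) auto
        moreover have "real W * \<epsilon>\<^sub>0 \<le> real W * \<epsilon>" using e by (intro mult_left_mono) auto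
        ultimately have "2 * \<gamma> \<le> \<epsilon>\<^sup>2" "1 \<le> real W * \<epsilon>"
          using gamma_bounds(3) W_bounds(2) by linarith+
        then show ?thesis unfolding \<Phi> Q using e_pos gamma_bounds(1) W_bounds(4)
          by (intro testable_disjunctive[OF bas 2(2,1), where \<eta> = "2 * \<gamma>" and \<delta>' = "1 / (2 * real W)"] chi)
            auto
      next
        case 3
        have "\<epsilon>\<^sub>0 * \<theta> ^ (k+1) \<le> \<epsilon> * \<theta> ^ (k+1)"
          using e theta_bounds by (intro mult_right_mono) auto
        then have eta: "2 * \<gamma> \<le> \<epsilon> * \<theta> ^ (k+1) / 2" by (simp add: gamma)
        have "real (2 * k) \<le> real W" using W_bounds(3) by linarith
        then have d: "real (2 * k) * (1 / (2 * real W)) \<le> 1 / 2"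
          using W_bounds(4) by (simp add: field_simps)
        have "testable (Gate f cs) b \<epsilon> (1/2) (2 * k * (2 * W * (2 * W * ?Q)))"
          using theta_bounds gamma_bounds(1) e e_pos False d eta
          by (intro testable_unforceable[OF bas 3(3,2), where \<theta> = \<theta> and \<eta> = "2 * \<gamma>"
                and \<delta>' = "1 / (2 * real W)"] chi) auto
        then show ?thesis unfolding \<Phi> Q
          by (rule testable_mono) (use W_bounds(3) in \<open>auto intro: mult_right_mono\<close>)
      qed
    qed
  qed
qed

text \<open>The root may be unanimous, hence one more \<open>testable_step\<close>; it needs
  \<open>\<epsilon>\<^sub>0 + \<gamma>\<close>, which is at most
  \<open>2 * \<epsilon>\<^sub>0\<close>. For \<open>n = W\<close> the threshold
  \<open>1 - n * \<gamma>\<close> is at most 0.\<close>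

lemma testable_k_x_basic:
  assumes "k_x_basic k X \<Phi>" "2 * \<epsilon>\<^sub>0 \<le> \<epsilon>"
  shows "testable \<Phi> b \<epsilon> (1/2) (2 * W * (4 * W ^ 3) ^ W)"
  using assms gamma_bounds W_bounds(1) e0
  by (intro testable_step[OF testable_non_unanimous, where n = W]) auto

end

section \<open>Final parameters and the resulting query bound\<close>

definition gap_constant :: "nat \<Rightarrow> real \<Rightarrow> real" where
  "gap_constant k \<epsilon> = (\<epsilon> / 2) * ((\<epsilon> / 2) / (2 * real k)) ^ (k+1) / 4"

definition rounds :: "nat \<Rightarrow> real \<Rightarrow> nat" where
  "rounds k \<epsilon> = nat \<lceil>1 / gap_constant k \<epsilon>\<rceil>"

definition query_bound :: "nat \<Rightarrow> real \<Rightarrow> real \<Rightarrow> nat" where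
  "query_bound k \<epsilon> \<delta> =
     nat \<lceil>1 / \<delta>\<rceil> * (2 * rounds k \<epsilon> * (4 * rounds k \<epsilon> ^ 3) ^ rounds k \<epsilon>)"

lemma testable_query_bound:
  assumes bas: "k_x_basic k X \<Phi>" and k: "2 \<le> k" and e: "0 < \<epsilon>" and d: "0 < \<delta>"
  shows "testable \<Phi> b \<epsilon> \<delta> (query_bound k \<epsilon> \<delta>)"
proof (cases "1 \<le> \<epsilon>")
  case True
  then show ?thesis by (rule testable_ge_1[OF bas])
next
  case False
  let ?R = "nat \<lceil>1 / \<delta>\<rceil>"
  \<comment> \<open>The recursion is run with \<open>\<epsilon>\<^sub>0 = \<epsilon> / 2\<close>;
    then \<open>gap_constant\<close> is \<open>\<gamma>\<close> and \<open>rounds\<close> is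
    \<open>W\<close>.\<close>
  have "testable \<Phi> b \<epsilon> (1/2) (2 * rounds k \<epsilon> * (4 * rounds k \<epsilon> ^ 3) ^ rounds k \<epsilon>)"
    using k e False bas
    by (intro testable_k_x_basic[of k "\<epsilon> / 2" "(\<epsilon> / 2) / (2 * real k)" "gap_constant k \<epsilon>"])
      (auto simp: gap_constant_def rounds_def)
  from testable_amplify[OF this, of ?R]
  have *: "testable \<Phi> b \<epsilon> ((1/2) ^ ?R) (query_bound k \<epsilon> \<delta>)" by (simp add: query_bound_def)
  have "1 / \<delta> \<le> real ?R" by linarith
  also have "\<dots> \<le> 2 ^ ?R" by (rule less_imp_le[OF of_nat_less_two_power])
  finally have "(1/2) ^ ?R \<le> \<delta>" using d by (simp add: power_one_over field_simps)
  then show ?thesis using testable_mono[OF *] by auto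
qed

text \<open>The number \<open>W\<close> of rounds is polynomial in \<open>1 / \<epsilon>\<close>,
  and \<open>(4 * W ^ 3) ^ W \<le> exp (4 * W ^ 4)\<close>. The parameter \<open>\<delta>\<close>
  enters only as the number of repetitions.\<close>

lemma query_bound_le:
  assumes k: "1 \<le> k"
  shows "\<exists>p :: real poly. \<forall>\<epsilon>>0. real (query_bound k \<epsilon> \<delta>) \<le> real (nat \<lceil>1 / \<delta>\<rceil>) * exp (poly p (1 / \<epsilon>))"
proof -
  \<comment> \<open>Expanding \<open>1 / gap_constant k \<epsilon>\<close> gives
    \<open>c * (1 / \<epsilon>) ^ (k+2)\<close>; the summand 1 in \<open>w\<close> pays for rounding
    up.\<close>
  define c where "c = 8 * (4 * real k) ^ (k+1)"
  define w :: "real poly" where "w = monom c (k+2) + 1"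
  have W: "real (rounds k \<epsilon>) \<le> poly w (1 / \<epsilon>)" if e: "\<epsilon> > 0" for \<epsilon>
  proof -
    have "1 / gap_constant k \<epsilon> = c * (1 / \<epsilon>) ^ (k+2)"
      using k e by (simp add: gap_constant_def c_def field_simps power_divide)
    moreover have "0 < gap_constant k \<epsilon>" using k e by (simp add: gap_constant_def)
    moreover have "real (nat \<lceil>x\<rceil>) \<le> x + 1" if "0 < x" for x :: real using that by linarith
    ultimately have "real (rounds k \<epsilon>) \<le> c * (1 / \<epsilon>) ^ (k+2) + 1"
      unfolding rounds_def by (metis zero_less_divide_1_iff)
    then show ?thesis unfolding w_def poly_add poly_monom poly_1 .
  qed
  have "real (query_bound k \<epsilon> \<delta>) \<le>
      real (nat \<lceil>1 / \<delta>\<rceil>) * exp (poly (smult 2 w + smult 4 (w ^ 4)) (1 / \<epsilon>))" if e: "\<epsilon> > 0" for \<epsilon>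
  proof -
    let ?W = "rounds k \<epsilon>"
    have le_exp: "x \<le> exp x" for x :: real using exp_ge_add_one_self[of x] by linarith
    have "real ((4 * ?W ^ 3) ^ ?W) = (4 * real ?W ^ 3) ^ ?W" by simp
    also have "\<dots> \<le> exp (4 * real ?W ^ 3) ^ ?W" by (intro power_mono le_exp) auto
    also have "\<dots> = exp (4 * real ?W ^ 4)"
      by (simp add: exp_of_nat_mult[symmetric] power4_eq_xxxx power3_eq_cube algebra_simps)
    finally have 1: "real ((4 * ?W ^ 3) ^ ?W) \<le> exp (4 * real ?W ^ 4)" .
    have "real (2 * ?W * (4 * ?W ^ 3) ^ ?W) = (2 * real ?W) * real ((4 * ?W ^ 3) ^ ?W)" by simp
    also have "\<dots> \<le> exp (2 * real ?W) * exp (4 * real ?W ^ 4)"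
      by (intro mult_mono le_exp 1) auto
    also have "\<dots> = exp (2 * real ?W + 4 * real ?W ^ 4)" by (simp add: exp_add)
    also have "\<dots> \<le> exp (2 * poly w (1 / \<epsilon>) + 4 * poly w (1 / \<epsilon>) ^ 4)"
      using W[OF e] by (auto intro!: add_mono power_mono)
    also have "\<dots> = exp (poly (smult 2 w + smult 4 (w ^ 4)) (1 / \<epsilon>))" by simp
    finally show ?thesis
      unfolding query_bound_def of_nat_mult[of "nat \<lceil>1 / \<delta>\<rceil>"] by (intro mult_left_mono) auto
  qed
  then show ?thesis by blast
qed

text \<open>Variables of \<open>X\<close> that label no leaf never have to change and only enlarge
  the denominator, so the distance relative to the leaves is at least the one relative to
  \<open>X\<close>.\<close>

lemma far_from_SAT_imp_hdist:
  assumes bas: "k_x_basic k X \<Phi>" and e: "0 \<le> \<epsilon>" and far: "eps_far X \<epsilon> \<sigma> (SAT \<Phi>)"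
  shows "\<epsilon> * size_of \<Phi> < hdist \<Phi> True \<sigma>"
proof -
  have X: "finite X" "vars \<Phi> \<subseteq> X" using bas by (auto simp: k_x_basic_def read_once_def)
  have vX: "card (vars \<Phi>) \<le> card X" using X by (intro card_mono)
  then have cX: "0 < real (card X)" using size_pos[OF bas] by linarith
  obtain \<tau> where \<tau>: "value_at \<tau> \<Phi>" "card {x \<in> vars \<Phi>. \<sigma> x \<noteq> \<tau> x} = hdist \<Phi> True \<sigma>"
    using hdist_attained[OF bas, of True \<sigma>] by auto
  \<comment> \<open>A nearest \<open>\<tau>\<close> is arbitrary off the leaves, so it is reset to
    \<open>\<sigma>\<close> there.\<close>
  define \<tau>' where "\<tau>' x = (if x \<in> vars \<Phi> then \<tau> x else \<sigma> x)" for x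
  have "value_at \<tau>' \<Phi> = value_at \<tau> \<Phi>" by (rule value_at_cong) (simp add: \<tau>'_def)
  then have "\<epsilon> < assignment_dist X \<sigma> \<tau>'" using far \<tau> by (auto simp: eps_far_def SAT_def)
  moreover have "{x \<in> X. \<sigma> x \<noteq> \<tau>' x} = {x \<in> vars \<Phi>. \<sigma> x \<noteq> \<tau> x}"
    using X by (auto simp: \<tau>'_def)
  ultimately have "\<epsilon> < real (hdist \<Phi> True \<sigma>) / real (card X)"
    using \<tau>(2) by (simp add: assignment_dist_def)
  then have "\<epsilon> * real (card X) < hdist \<Phi> True \<sigma>" using cX by (simp add: field_simps)
  moreover have "\<epsilon> * size_of \<Phi> \<le> \<epsilon> * real (card X)" using vX e by (intro mult_left_mono) auto
  ultimately show ?thesis by linarith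
qed

theorem theorem3p1:
  fixes k :: nat
  assumes "k \<ge> 2"
  shows "\<exists>A :: 'x set \<Rightarrow> 'x formula \<Rightarrow> real \<Rightarrow> real \<Rightarrow> 'x randomized_tree.
    (\<forall>X \<Phi> \<epsilon> \<delta>. k_x_basic k X \<Phi> \<and> \<epsilon> > 0 \<and> \<delta> > 0 \<longrightarrow>
       (\<forall>t \<in> set_pmf (A X \<Phi> \<epsilon> \<delta>). set_decision_tree t \<subseteq> X) \<and>
       (\<forall>\<sigma> \<in> SAT \<Phi>. \<forall>t \<in> set_pmf (A X \<Phi> \<epsilon> \<delta>). accepts t \<sigma>) \<and>
       (\<forall>\<sigma>. eps_far X \<epsilon> \<sigma> (SAT \<Phi>) \<longrightarrow>
          measure_pmf.prob (A X \<Phi> \<epsilon> \<delta>) {t. \<not> accepts t \<sigma>} \<ge> 1 - \<delta>)) \<and>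
    (\<forall>\<delta>>0. \<exists>(C::real) (p::real poly). \<forall>\<epsilon>>0. \<forall>X \<Phi>. k_x_basic k X \<Phi> \<longrightarrow>
       (\<forall>t \<in> set_pmf (A X \<Phi> \<epsilon> \<delta>). \<forall>\<sigma>.
          real (num_queries t \<sigma>) \<le> C * exp (poly p (1 / \<epsilon>))))"
proof -
  \<comment> \<open>Since \<open>query_bound\<close> depends on \<open>k\<close>,
    \<open>\<epsilon>\<close> and \<open>\<delta>\<close> alone, the query count is uniform over all
    formulas and variable sets.\<close>
  define A :: "'x set \<Rightarrow> 'x formula \<Rightarrow> real \<Rightarrow> real \<Rightarrow> 'x randomized_tree" where
    "A X \<Phi> \<epsilon> \<delta> = chosen_tester \<Phi> True \<epsilon> \<delta> (query_bound k \<epsilon> \<delta>)" for X \<Phi> \<epsilon> \<delta>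
  have "set_decision_tree t \<subseteq> X" and "num_queries t \<sigma> \<le> query_bound k \<epsilon> \<delta>"
    if bas: "k_x_basic k X \<Phi>" and ed: "\<epsilon> > 0" "\<delta> > 0" and t: "t \<in> set_pmf (A X \<Phi> \<epsilon> \<delta>)"
    for X :: "'x set" and \<Phi> \<epsilon> \<delta> t \<sigma>
    using chosen_tester(1)[OF testable_query_bound[OF bas assms ed], of True] t bas
    by (auto simp: A_def bounded_tester_def k_x_basic_def read_once_def)
  note A = this
  have acc: "accepts t \<sigma>"
    if bas: "k_x_basic k X \<Phi>" and ed: "\<epsilon> > 0" "\<delta> > 0" and s: "\<sigma> \<in> SAT \<Phi>"
      and t: "t \<in> set_pmf (A X \<Phi> \<epsilon> \<delta>)" for X :: "'x set" and \<Phi> \<epsilon> \<delta> t \<sigma>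
    using chosen_tester(2)[OF testable_query_bound[OF bas assms ed], of \<sigma> True t] s t
    by (simp add: A_def SAT_def)
  have rej: "1 - \<delta> \<le> measure_pmf.prob (A X \<Phi> \<epsilon> \<delta>) {t. \<not> accepts t \<sigma>}"
    if bas: "k_x_basic k X \<Phi>" and ed: "\<epsilon> > 0" "\<delta> > 0" and far: "eps_far X \<epsilon> \<sigma> (SAT \<Phi>)"
    for X :: "'x set" and \<Phi> \<epsilon> \<delta> \<sigma>
  proof -
    have "measure_pmf.prob (A X \<Phi> \<epsilon> \<delta>) {t. accepts t \<sigma>} \<le> \<delta>"
      unfolding A_def using ed
      by (intro chosen_tester(3) testable_query_bound[OF bas assms] far_from_SAT_imp_hdist[OF bas _ far]) auto
    moreover have "measure_pmf.prob (A X \<Phi> \<epsilon> \<delta>) {t. \<not> accepts t \<sigma>} =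
        1 - measure_pmf.prob (A X \<Phi> \<epsilon> \<delta>) {t. accepts t \<sigma>}"
      using measure_pmf.prob_compl[of "{t. accepts t \<sigma>}" "A X \<Phi> \<epsilon> \<delta>"]
      by (simp add: Collect_neg_eq Compl_eq_Diff_UNIV)
    ultimately show ?thesis by linarith
  qed
  have bound: "\<exists>(C::real) (p::real poly). \<forall>\<epsilon>>0. \<forall>X \<Phi>. k_x_basic k X \<Phi> \<longrightarrow>
      (\<forall>t \<in> set_pmf (A X \<Phi> \<epsilon> \<delta>). \<forall>\<sigma>. real (num_queries t \<sigma>) \<le> C * exp (poly p (1 / \<epsilon>)))"
    if d: "\<delta> > 0" for \<delta>
  proof -
    have "1 \<le> k" using assms by simp
    from query_bound_le[OF this, of \<delta>] obtain p :: "real poly" where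
      p: "\<And>\<epsilon>. \<epsilon> > 0 \<Longrightarrow> real (query_bound k \<epsilon> \<delta>) \<le> real (nat \<lceil>1 / \<delta>\<rceil>) * exp (poly p (1 / \<epsilon>))"
      by blast
    show ?thesis
      by (intro exI allI impI ballI)
        (rule order_trans[OF of_nat_mono[OF A(2)[OF _ _ d]] p])
  qed
  show ?thesis
    by (intro exI[of _ A] conjI allI impI ballI; (elim conjE)?; rule A(1) acc rej bound; assumption)
qed

end
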